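(* Let $H:\mathbb{R}^N\to\mathbb{R}$ be a (differentiable) energy function for the equation $$\frac{dx}{dt}=\Bigl(\frac{\partial u}{\partial x}\Bigr)^{-1}S\Bigl(\frac{\partial u}{\partial x}\Bigr)^{-\top}\frac{\partial H}{\partial x},$$ where $x:t\in\mathbb{R}\mapsto x(t)\in\mathbb{R}^N$, $u:x\in\mathbb{R}^N\mapsto u(x)\in\mathbb{R}^N$, and $S$ is an $N\times N$ real matrix. Suppose that the phase space $K\subset\mathbb{R}^N$ of this system is compact and that $\partial H/\partial u$ is Lipschitz continuous on the phase space. Suppose also that $u$ is a $C^1$-diffeomorphism. If the functions $\sigma\neq0$ and $\rho\neq0$ belong to $S^1_2(\mathbb{R})$, then for any $\varepsilon>0$ there exist neural networks $H_{\mathrm{NN}}:\mathbb{R}^N\to\mathbb{R}$ with activation function $\sigma$ and $u_{\mathrm{NN}}:\mathbb{R}^N\to\mathbb{R}^N$ with activation function $\rho$ for which $$\left\|\Bigl(\frac{\partial u}{\partial x}\Bigr)^{-1}S\Bigl(\frac{\partial u}{\partial x}\Bigr)^{-\top}\frac{\partial H}{\partial x}-\Bigl(\frac{\partial u_{\mathrm{NN}}}{\partial x}\Bigr)^{-1}S\Bigl(\frac{\partial u_{\mathrm{NN}}}{\partial x}\Bigr)^{-\top}\frac{\partial H_{\mathrm{NN}}}{\partial x}\right\|_{L^2(K)}<\varepsilon .$$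
   Context: $\partial u/\partial x$ denotes the Jacobian matrix of $u$, $\partial H/\partial x$ the gradient (column vector) of $H$ with respect to $x$, and $A^{-\top}=(A^{-1})^\top$. $\partial H/\partial u$ denotes the gradient of the energy with respect to the transformed coordinate $u=u(x)$, i.e. $\partial H/\partial u=(\partial u/\partial x)^{-\top}\,\partial H/\partial x$. The claim includes that the Jacobian $\partial u_{\mathrm{NN}}/\partial x$ is invertible on $K$, so that the displayed expression is defined. For an integer $m\ge0$ and $1\le p\le\infty$, $W^{p,m}(X)$ is the Sobolev space of functions on $X$ having weak derivatives up to order $m$ in $L^p$, and $S^m_p(X)$ is $C^m(X)$ with the topology of $W^{p,m}(X)$, i.e. the space of functions in $W^{p,m}(X)$ with (usual) derivatives up to order $m$. In particular $\sigma\in S^1_2(\mathbb{R})$ means that $\sigma$ is $C^1$ with $\sigma,\sigma'\in L^2(\mathbb{R})$; $\sigma\ne0$ means not identically zero. A (scalar) neural network with activation function $\sigma$ is a one-hidden-layer network $x\mapsto\sum_{j=1}^q\beta_j\,\sigma(a_j\cdot x+b_j)$ with $q\in\mathbb{N}$, $\beta_j,b_j\in\mathbb{R}$, $a_j\in\mathbb{R}^N$; an $\mathbb{R}^N$-valued neural network is defined in the same way with $\beta_j\in\mathbb{R}^N$. *)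

theory Defs
  imports "HOL-Analysis.Analysis"
begin

text \<open>Gradient as the column vector of partial derivatives.\<close>

definition gradient :: "(real^'n \<Rightarrow> real) \<Rightarrow> real^'n \<Rightarrow> real^'n" where
  "gradient f x = (\<chi> i. frechet_derivative f (at x) (axis i 1))"

lemma GDERIV_gradient:
  assumes "f differentiable (at x)"
  shows "GDERIV f x :> gradient f x"
proof -
  let ?D = "frechet_derivative f (at x)"
  have D: "(f has_derivative ?D) (at x)"
    using assms by (simp add: frechet_derivative_works)
  then have lin: "linear ?D"
    by (rule has_derivative_linear)
  have "?D h = h \<bullet> gradient f x" for h
  proof -
    have "?D h = ?D (\<Sum>i\<in>UNIV. (h $ i) *\<^sub>R axis i 1)"
      by (simp add: basis_expansion flip: scalar_mult_eq_scaleR)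
    also have "\<dots> = (\<Sum>i\<in>UNIV. (h $ i) * ?D (axis i 1))"
      by (simp add: linear_sum[OF lin] linear_cmul[OF lin])
    also have "\<dots> = h \<bullet> gradient f x"
      by (simp add: gradient_def inner_vec_def)
    finally show ?thesis .
  qed
  then have "?D = (\<lambda>h. h \<bullet> gradient f x)" by (rule ext)
  with D show ?thesis
    by (simp add: gderiv_def)
qed

definition C1_map :: "(real^'n \<Rightarrow> real^'m) \<Rightarrow> bool" where
  "C1_map u \<longleftrightarrow> (\<forall>x. u differentiable (at x)) \<and> continuous_on UNIV (\<lambda>x. jacobian u (at x))"

definition C1_diffeomorphism :: "(real^'n \<Rightarrow> real^'n) \<Rightarrow> bool" where
  "C1_diffeomorphism u \<longleftrightarrow> bij u \<and> C1_map u \<and> C1_map (inv u)"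

text \<open>The gradient of \<open>H\<close> with respect to the coordinate \<open>u = u(x)\<close>, as a function of \<open>x\<close>.\<close>

definition gradient_wrt ::
  "(real^'n \<Rightarrow> real^'n) \<Rightarrow> (real^'n \<Rightarrow> real) \<Rightarrow> real^'n \<Rightarrow> real^'n" where
  "gradient_wrt u H x = transpose (matrix_inv (jacobian u (at x))) *v gradient H x"

definition transformed_field ::
  "(real^'n \<Rightarrow> real^'n) \<Rightarrow> real^'n^'n \<Rightarrow> (real^'n \<Rightarrow> real) \<Rightarrow> real^'n \<Rightarrow> real^'n" where
  "transformed_field u S H x =
     (matrix_inv (jacobian u (at x)) ** S ** transpose (matrix_inv (jacobian u (at x))))
       *v gradient H x"

text \<open>
  The Bochner integral of a non-integrable function is \<open>0\<close>, so a bound on \<open>L2_norm\<close> is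
  meaningful only together with \<open>square_integrable_on\<close>.
\<close>

definition square_integrable_on ::
  "('a::euclidean_space \<Rightarrow> 'b::euclidean_space) \<Rightarrow> 'a set \<Rightarrow> bool" where
  "square_integrable_on f A \<longleftrightarrow>
     set_borel_measurable lebesgue A f \<and> set_integrable lebesgue A (\<lambda>x. (norm (f x))\<^sup>2)"

definition L2_norm ::
  "'a::euclidean_space set \<Rightarrow> ('a \<Rightarrow> 'b::euclidean_space) \<Rightarrow> real" where
  "L2_norm A f = sqrt (LINT x:A|lebesgue. (norm (f x))\<^sup>2)"

text \<open>The space $S^1_2(\mathbb{R})$: \<open>C\<^sup>1\<close> functions with \<open>\<sigma>\<close> and \<open>\<sigma>'\<close> in \<open>L\<^sup>2\<close>.\<close>

definition S12 :: "(real \<Rightarrow> real) set" where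
  "S12 = {\<sigma>. \<sigma> C1_differentiable_on UNIV \<and>
             square_integrable_on \<sigma> UNIV \<and> square_integrable_on (deriv \<sigma>) UNIV}"

text \<open>One-hidden-layer networks; the output weights \<open>\<beta> j\<close> lie in the codomain.\<close>

definition neural_networks ::
  "(real \<Rightarrow> real) \<Rightarrow> (real^'n \<Rightarrow> 'b::real_vector) set" where
  "neural_networks \<sigma> =
     {\<lambda>x. \<Sum>j=1..q. \<sigma> (a j \<bullet> x + b j) *\<^sub>R \<beta> j |
        (q::nat) (a::nat \<Rightarrow> real^'n) (b::nat \<Rightarrow> real) (\<beta>::nat \<Rightarrow> 'b). True}"

end

theory Submission
  imports Defs "HOL-Real_Asymp.Real_Asymp"
begin

text \<open>The map \<open>(A, v) \<mapsto> A\<^sup>-\<^sup>1 S A\<^sup>-\<^sup>\<top> v\<close> is continuous on the open set where \<open>A\<close> is invertible, and the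
  Jacobian of \<open>u\<close> and the gradient of \<open>H\<close> are continuous on \<open>K\<close>, the latter because it is the
  transposed Jacobian applied to the Lipschitz field \<open>\<partial>H/\<partial>u\<close>. Hence it suffices to approximate
  \<open>\<nabla>H\<close> and the rows of the Jacobian of \<open>u\<close> uniformly on \<open>K\<close> by gradients of networks: closeness
  of the Jacobians gives invertibility, and the fields are then uniformly close on \<open>K\<close>, which
  bounds the \<open>L\<^sup>2\<close> norm. The approximation is \<open>network_gradient_approximation\<close>; it rests on
  three constructions.

  A potential on \<open>K\<close> (\<open>chain_potential\<close>). Away from \<open>K\<close> the function \<open>H\<close> is merely
  differentiable, its gradient may be unbounded there, and \<open>K\<close> may have empty interior; also the Taylor remainder of \<open>H\<close>
  at points of \<open>K\<close> need not be uniform, so neither smoothing \<open>H\<close> nor Whitney's extension theorem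
  applies. Instead \<open>H\<close> is replaced by another function with almost the same gradient on \<open>K\<close>. Fix
  \<open>\<eta> > 0\<close> and charge a step from \<open>y\<close> to \<open>z\<close> in \<open>K\<close> the price
  \<open>\<nabla>H(y) \<bullet> (z - y) + \<eta> \<bar>z - y\<bar>\<close>. The cheapest way \<open>f(x)\<close> of reaching \<open>x\<close> by steps of length at most
  \<open>\<delta>\<close>, when starting at \<open>p\<close> costs \<open>H(p)\<close>, satisfies
  \<open>\<bar>f(x) - f(y) - \<nabla>H(y) \<bullet> (x - y)\<bar> \<le> 2 \<eta> \<bar>x - y\<bar>\<close> uniformly for near \<open>x, y\<close>. The
  point is that the infimum is finite for small \<open>\<delta>\<close>. Otherwise there are for every \<open>\<delta>\<close> chains of
  length between \<open>1\<close> and \<open>3\<close> that are cheaper than the increment of \<open>H\<close>; bisecting them and passing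
  to limits, by compactness, gives a point of \<open>K\<close> near which chains at all scales stay too cheap,
  contradicting the differentiability of \<open>H\<close> at this single point.

  From the potential to polynomials (\<open>C1_limit_of_jet\<close>). The first-order Taylor
  polynomials of \<open>f\<close>, formed with \<open>\<nabla>H\<close> in place of its gradient, are glued by a
  \<open>C\<^sup>1\<close> partition of unity on a fine grid. The uniform remainder estimate compensates the growth of
  the gradients of the partition, so the glued function has gradient within \<open>C \<eta>\<close> of \<open>\<nabla>H\<close> on
  \<open>K\<close>, and it is a \<open>C\<^sup>1\<close> limit of polynomials.

  From polynomials to networks (\<open>polynomial_in_C1_closure\<close>). Differentiating \<open>\<sigma>(a \<bullet> x + b)\<close> with respect to
  the weight \<open>a\<close> produces factors \<open>v \<bullet> x\<close>, so every monomial times a derivative of \<open>\<sigma>\<close> would be a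
  limit of networks if \<open>\<sigma>\<close> were smooth. Averaging \<open>\<sigma>\<close> over unit intervals before each
  differentiation replaces derivatives by the differences \<open>\<sigma>(t + 1) - \<sigma>(t)\<close>, for which \<open>C\<^sup>1\<close> is
  enough. Setting \<open>a = 0\<close> leaves the monomial itself times an iterated difference of \<open>\<sigma>\<close> at a point. Such a
  difference is nonzero somewhere because \<open>\<sigma>\<close> is square integrable (\<open>unit_difference_power_nonzero\<close>).\<close>

section \<open>Functions with continuous gradient and their locally uniform limits\<close>

definition has_C1_gradient :: "('a::euclidean_space \<Rightarrow> real) \<Rightarrow> ('a \<Rightarrow> 'a) \<Rightarrow> bool" where
  "has_C1_gradient f f' \<longleftrightarrow> (\<forall>x. GDERIV f x :> f' x) \<and> continuous_on UNIV f'"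

lemma has_C1_gradient_continuous:
  assumes "has_C1_gradient f f'" shows "continuous_on A f"
  using assms unfolding has_C1_gradient_def gderiv_def
  by (meson continuous_at_imp_continuous_on has_derivative_continuous)

lemma has_C1_gradient_scale:
  assumes "has_C1_gradient f f'"
  shows "has_C1_gradient (\<lambda>x. c * f x) (\<lambda>x. c *\<^sub>R f' x)"
proof -
  have "GDERIV (\<lambda>x. c * f x) x :> c *\<^sub>R f' x" for x
    using GDERIV_mult[OF GDERIV_const[of c x], of f "f' x"] assms
    by (simp add: has_C1_gradient_def)
  then show ?thesis using assms by (auto simp: has_C1_gradient_def intro!: continuous_intros)
qed

lemma has_C1_gradient_const: "has_C1_gradient (\<lambda>x. c) (\<lambda>x. 0)"
  by (simp add: has_C1_gradient_def GDERIV_const)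

lemma has_C1_gradient_add:
  assumes "has_C1_gradient f f'" "has_C1_gradient g g'"
  shows "has_C1_gradient (\<lambda>x. f x + g x) (\<lambda>x. f' x + g' x)"
  using assms by (auto simp: has_C1_gradient_def intro!: continuous_intros GDERIV_add)

lemma has_C1_gradient_mult:
  assumes f: "has_C1_gradient f f'" and g: "has_C1_gradient g g'"
  shows "has_C1_gradient (\<lambda>x. f x * g x) (\<lambda>x. f x *\<^sub>R g' x + g x *\<^sub>R f' x)"
  using assms has_C1_gradient_continuous[OF f] has_C1_gradient_continuous[OF g]
  by (auto simp: has_C1_gradient_def intro!: continuous_intros GDERIV_mult)

lemma has_C1_gradient_ridge:
  fixes a :: "'a::euclidean_space"
  assumes "\<And>t. (\<phi> has_real_derivative \<phi>' t) (at t)" "continuous_on UNIV \<phi>'"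
  shows "has_C1_gradient (\<lambda>x. \<phi> (a \<bullet> x + b)) (\<lambda>x. \<phi>' (a \<bullet> x + b) *\<^sub>R a)"
proof -
  have "GDERIV (\<lambda>x. a \<bullet> x + b) x :> a" for x
    unfolding gderiv_def by (auto intro!: derivative_eq_intros simp: inner_commute)
  then have "GDERIV (\<lambda>x. \<phi> (a \<bullet> x + b)) x :> \<phi>' (a \<bullet> x + b) *\<^sub>R a" for x
    by (rule GDERIV_DERIV_compose[OF _ assms(1)])
  moreover have "continuous_on UNIV (\<lambda>x. \<phi>' (a \<bullet> x + b))"
    by (rule continuous_on_compose2[OF assms(2)]) (auto intro!: continuous_intros)
  ultimately show ?thesis by (auto simp: has_C1_gradient_def intro!: continuous_intros)
qed

text \<open>Convergence in \<open>C\<^sup>1\<close>, uniformly on every ball. The gradient is an explicit argument, since all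
  estimates are about it; \<open>C1_closure\<close> below forgets it again.\<close>

definition C1_limit ::
  "('a::euclidean_space \<Rightarrow> real) set \<Rightarrow> ('a \<Rightarrow> real) \<Rightarrow> ('a \<Rightarrow> 'a) \<Rightarrow> bool" where
  "C1_limit V f f' \<longleftrightarrow> has_C1_gradient f f' \<and>
     (\<forall>R. \<forall>e>0. \<exists>g\<in>V. \<exists>g'. has_C1_gradient g g' \<and>
        (\<forall>x\<in>cball 0 R. \<bar>g x - f x\<bar> < e \<and> norm (g' x - f' x) < e))"

lemma C1_limit_has_C1_gradient: "C1_limit V f f' \<Longrightarrow> has_C1_gradient f f'"
  by (simp add: C1_limit_def)

lemma C1_limit_approx:
  assumes "C1_limit V f f'" "e > 0"
  obtains g g' where "g \<in> V" "has_C1_gradient g g'"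
    "\<And>x. norm x \<le> R \<Longrightarrow> \<bar>g x - f x\<bar> < e" "\<And>x. norm x \<le> R \<Longrightarrow> norm (g' x - f' x) < e"
proof -
  obtain g g' where "g \<in> V" "has_C1_gradient g g'"
    "\<forall>x\<in>cball 0 R. \<bar>g x - f x\<bar> < e \<and> norm (g' x - f' x) < e"
    using assms unfolding C1_limit_def by blast
  then show ?thesis using that[of g g'] by simp
qed

lemma C1_limit_self: "f \<in> V \<Longrightarrow> has_C1_gradient f f' \<Longrightarrow> C1_limit V f f'"
  unfolding C1_limit_def by (auto intro!: bexI[of _ f] exI[of _ f'])

lemma C1_limit_sequence:
  assumes "C1_limit V f f'"
  obtains g g' where "\<And>n::nat. g n \<in> V" "\<And>n. has_C1_gradient (g n) (g' n)"
    "uniform_limit (cball 0 R) g f sequentially" "uniform_limit (cball 0 R) g' f' sequentially"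
proof -
  define P where "P n g g' \<longleftrightarrow> g \<in> V \<and> has_C1_gradient g g' \<and>
      (\<forall>x\<in>cball 0 R. \<bar>g x - f x\<bar> < 1 / real (Suc n) \<and> norm (g' x - f' x) < 1 / real (Suc n))"
    for n g g'
  have "\<forall>n. \<exists>g g'. P n g g'"
  proof
    fix n
    have "1 / real (Suc n) > 0" by simp
    then show "\<exists>g g'. P n g g'" using assms unfolding C1_limit_def P_def by blast
  qed
  then obtain g g' where "\<And>n. P n (g n) (g' n)" by metis
  then have g: "g n \<in> V" "has_C1_gradient (g n) (g' n)"
    "x \<in> cball 0 R \<Longrightarrow> \<bar>g n x - f x\<bar> < 1 / real (Suc n)"
    "x \<in> cball 0 R \<Longrightarrow> norm (g' n x - f' x) < 1 / real (Suc n)" for n x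
    by (auto simp: P_def)
  have lim: "(\<lambda>n. 1 / real (Suc n)) \<longlonglongrightarrow> 0"
    using LIMSEQ_inverse_real_of_nat by (simp add: inverse_eq_divide)
  have small: "\<forall>\<^sub>F n in sequentially. 1 / real (Suc n) < e" if "e > 0" for e
    by (rule order_tendstoD(2)[OF lim that])
  have "uniform_limit (cball 0 R) g f sequentially"
    by (rule uniform_limitI, rule eventually_mono[OF small]) (auto simp: dist_norm intro: less_trans[OF g(3)])
  moreover have "uniform_limit (cball 0 R) g' f' sequentially"
    by (rule uniform_limitI, rule eventually_mono[OF small]) (auto simp: dist_norm intro: less_trans[OF g(4)])
  ultimately show ?thesis by (rule that[OF g(1,2)])
qed

text \<open>Limits of limits are limits. This is what allows several approximation steps to be chained
  without carrying error terms.\<close>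

lemma C1_limit_of_C1_limits:
  assumes f: "has_C1_gradient f f'"
    and lim: "\<And>R. \<exists>g g'. (\<forall>n::nat. C1_limit V (g n) (g' n)) \<and>
      uniform_limit (cball 0 R) g f sequentially \<and> uniform_limit (cball 0 R) g' f' sequentially"
  shows "C1_limit V f f'"
  unfolding C1_limit_def
proof (intro conjI f allI impI)
  fix R e :: real assume e: "e > 0"
  obtain g g' where g: "\<And>n::nat. C1_limit V (g n) (g' n)"
      "uniform_limit (cball 0 R) g f sequentially" "uniform_limit (cball 0 R) g' f' sequentially"
    using lim[of R] by blast
  have "\<forall>\<^sub>F n in sequentially. (\<forall>x\<in>cball 0 R. dist (g n x) (f x) < e/2) \<and>
      (\<forall>x\<in>cball 0 R. dist (g' n x) (f' x) < e/2)"
    using g(2,3)[THEN uniform_limitD, of "e/2"] e by (simp add: eventually_conj)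
  then obtain n where "(\<forall>x\<in>cball 0 R. dist (g n x) (f x) < e/2) \<and>
      (\<forall>x\<in>cball 0 R. dist (g' n x) (f' x) < e/2)"
    using eventually_happens'[OF sequentially_bot] by blast
  then have n: "\<bar>g n x - f x\<bar> < e/2" "norm (g' n x - f' x) < e/2" if "norm x \<le> R" for x
    using that by (auto simp: dist_norm)
  obtain h h' where h: "h \<in> V" "has_C1_gradient h h'"
    "\<And>x. norm x \<le> R \<Longrightarrow> \<bar>h x - g n x\<bar> < e/2" "\<And>x. norm x \<le> R \<Longrightarrow> norm (h' x - g' n x) < e/2"
    using C1_limit_approx[OF g(1)[of n], of "e/2" R] e by (metis half_gt_zero)
  have "\<bar>h x - f x\<bar> < e \<and> norm (h' x - f' x) < e" if "norm x \<le> R" for x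
    using n[OF that] h(3,4)[OF that] norm_triangle_ineq[of "h' x - g' n x" "g' n x - f' x"]
    by (auto simp: abs_if split: if_splits)
  with h show "\<exists>g\<in>V. \<exists>g'. has_C1_gradient g g' \<and>
      (\<forall>x\<in>cball 0 R. \<bar>g x - f x\<bar> < e \<and> norm (g' x - f' x) < e)"
    by (intro bexI[of _ h] exI[of _ h']) auto
qed

lemma C1_limit_mono:
  assumes "C1_limit V f f'" and "\<And>g g'. g \<in> V \<Longrightarrow> has_C1_gradient g g' \<Longrightarrow> C1_limit W g g'"
  shows "C1_limit W f f'"
proof (rule C1_limit_of_C1_limits[OF C1_limit_has_C1_gradient[OF assms(1)]])
  fix R
  show "\<exists>g g'. (\<forall>n::nat. C1_limit W (g n) (g' n)) \<and>
      uniform_limit (cball 0 R) g f sequentially \<and> uniform_limit (cball 0 R) g' f' sequentially"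
  proof -
    obtain g g' where "\<And>n::nat. g n \<in> V" "\<And>n. has_C1_gradient (g n) (g' n)"
      "uniform_limit (cball 0 R) g f sequentially" "uniform_limit (cball 0 R) g' f' sequentially"
      using C1_limit_sequence[OF assms(1), where R = R] by blast
    then show ?thesis using assms(2) by blast
  qed
qed

lemma C1_limit_add:
  assumes V: "\<And>f g. f \<in> V \<Longrightarrow> g \<in> V \<Longrightarrow> (\<lambda>x. f x + g x) \<in> V"
    and f: "C1_limit V f f'" and g: "C1_limit V g g'"
  shows "C1_limit V (\<lambda>x. f x + g x) (\<lambda>x. f' x + g' x)"
proof (rule C1_limit_of_C1_limits)
  show "has_C1_gradient (\<lambda>x. f x + g x) (\<lambda>x. f' x + g' x)"
    using f g by (simp add: C1_limit_def has_C1_gradient_add)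
  fix R
  obtain p p' where p: "\<And>n::nat. p n \<in> V" "\<And>n. has_C1_gradient (p n) (p' n)"
    "uniform_limit (cball 0 R) p f sequentially" "uniform_limit (cball 0 R) p' f' sequentially"
    using C1_limit_sequence[OF f, where R = R] by blast
  obtain q q' where q: "\<And>n::nat. q n \<in> V" "\<And>n. has_C1_gradient (q n) (q' n)"
    "uniform_limit (cball 0 R) q g sequentially" "uniform_limit (cball 0 R) q' g' sequentially"
    using C1_limit_sequence[OF g, where R = R] by blast
  show "\<exists>h h'. (\<forall>n::nat. C1_limit V (h n) (h' n)) \<and>
      uniform_limit (cball 0 R) h (\<lambda>x. f x + g x) sequentially \<and>
      uniform_limit (cball 0 R) h' (\<lambda>x. f' x + g' x) sequentially"
    by (rule exI[of _ "\<lambda>n x. p n x + q n x"], rule exI[of _ "\<lambda>n x. p' n x + q' n x"])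
      (auto intro!: C1_limit_self V p q has_C1_gradient_add uniform_limit_intros)
qed

text \<open>Multiplication is continuous because the limit functions and their gradients are bounded on balls.\<close>

lemma C1_limit_mult:
  assumes V: "\<And>f g. f \<in> V \<Longrightarrow> g \<in> V \<Longrightarrow> (\<lambda>x. f x * g x) \<in> V"
    and f: "C1_limit V f f'" and g: "C1_limit V g g'"
  shows "C1_limit V (\<lambda>x. f x * g x) (\<lambda>x. f x *\<^sub>R g' x + g x *\<^sub>R f' x)"
proof (rule C1_limit_of_C1_limits)
  have fC: "has_C1_gradient f f'" and gC: "has_C1_gradient g g'"
    using f g by (auto simp: C1_limit_def)
  show "has_C1_gradient (\<lambda>x. f x * g x) (\<lambda>x. f x *\<^sub>R g' x + g x *\<^sub>R f' x)"
    by (rule has_C1_gradient_mult[OF fC gC])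
  fix R
  obtain p p' where p: "\<And>n::nat. p n \<in> V" "\<And>n. has_C1_gradient (p n) (p' n)"
    "uniform_limit (cball 0 R) p f sequentially" "uniform_limit (cball 0 R) p' f' sequentially"
    using C1_limit_sequence[OF f, where R = R] by blast
  obtain q q' where q: "\<And>n::nat. q n \<in> V" "\<And>n. has_C1_gradient (q n) (q' n)"
    "uniform_limit (cball 0 R) q g sequentially" "uniform_limit (cball 0 R) q' g' sequentially"
    using C1_limit_sequence[OF g, where R = R] by blast
  have bdd: "bounded (h ` cball 0 R)" if "continuous_on UNIV h" for h :: "'a \<Rightarrow> 'b::real_normed_vector"
    by (intro compact_imp_bounded compact_continuous_image continuous_on_subset[OF that]) auto
  have b: "bounded (f ` cball 0 R)" "bounded (g ` cball 0 R)" "bounded (f' ` cball 0 R)" "bounded (g' ` cball 0 R)"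
    using fC gC by (auto intro!: bdd has_C1_gradient_continuous simp: has_C1_gradient_def)
  show "\<exists>h h'. (\<forall>n::nat. C1_limit V (h n) (h' n)) \<and>
      uniform_limit (cball 0 R) h (\<lambda>x. f x * g x) sequentially \<and>
      uniform_limit (cball 0 R) h' (\<lambda>x. f x *\<^sub>R g' x + g x *\<^sub>R f' x) sequentially"
    by (rule exI[of _ "\<lambda>n x. p n x * q n x"], rule exI[of _ "\<lambda>n x. p n x *\<^sub>R q' n x + q n x *\<^sub>R p' n x"])
      (auto intro!: C1_limit_self V p q has_C1_gradient_mult uniform_limit_intros b)
qed

lemma C1_limit_sum:
  assumes V: "\<And>f g. f \<in> V \<Longrightarrow> g \<in> V \<Longrightarrow> (\<lambda>x. f x + g x) \<in> V" and "(\<lambda>_. 0) \<in> V"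
    and "finite I" "\<And>i. i \<in> I \<Longrightarrow> C1_limit V (f i) (f' i)"
  shows "C1_limit V (\<lambda>x. \<Sum>i\<in>I. f i x) (\<lambda>x. \<Sum>i\<in>I. f' i x)"
  using assms(3,4)
proof (induction I)
  case empty
  then show ?case using assms(2) by (simp add: C1_limit_self has_C1_gradient_const)
next
  case (insert i I)
  have "C1_limit V (\<lambda>x. f i x + (\<Sum>i\<in>I. f i x)) (\<lambda>x. f' i x + (\<Sum>i\<in>I. f' i x))"
    by (rule C1_limit_add[OF V]) (use insert in auto)
  then show ?case by (simp add: insert.hyps)
qed

lemma C1_limit_scale:
  assumes V: "\<And>c f. f \<in> V \<Longrightarrow> (\<lambda>x. c * f x) \<in> V" and f: "C1_limit V f f'"
  shows "C1_limit V (\<lambda>x. c * f x) (\<lambda>x. c *\<^sub>R f' x)"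
proof (rule C1_limit_of_C1_limits)
  show "has_C1_gradient (\<lambda>x. c * f x) (\<lambda>x. c *\<^sub>R f' x)"
    using f by (simp add: C1_limit_def has_C1_gradient_scale)
  fix R
  obtain p p' where p: "\<And>n::nat. p n \<in> V" "\<And>n. has_C1_gradient (p n) (p' n)"
    "uniform_limit (cball 0 R) p f sequentially" "uniform_limit (cball 0 R) p' f' sequentially"
    using C1_limit_sequence[OF f, where R = R] by blast
  show "\<exists>h h'. (\<forall>n::nat. C1_limit V (h n) (h' n)) \<and>
      uniform_limit (cball 0 R) h (\<lambda>x. c * f x) sequentially \<and>
      uniform_limit (cball 0 R) h' (\<lambda>x. c *\<^sub>R f' x) sequentially"
    by (rule exI[of _ "\<lambda>n x. c * p n x"], rule exI[of _ "\<lambda>n x. c *\<^sub>R p' n x"])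
      (auto intro!: C1_limit_self V p has_C1_gradient_scale
        bounded_linear.uniform_limit[OF bounded_linear_mult_right]
        bounded_linear.uniform_limit[OF bounded_linear_scaleR_right])
qed

definition C1_closure :: "('a::euclidean_space \<Rightarrow> real) set \<Rightarrow> ('a \<Rightarrow> real) set" where
  "C1_closure V = {f. \<exists>f'. C1_limit V f f'}"

lemma C1_limit_unique:
  assumes "C1_limit V f f'" "has_C1_gradient f f''"
  shows "C1_limit V f f''"
proof -
  have "f' = f''"
  proof
    fix x
    have "GDERIV f x :> f' x" "GDERIV f x :> f'' x"
      using assms by (auto simp: C1_limit_def has_C1_gradient_def)
    then have eq: "(\<lambda>h. h \<bullet> f' x) = (\<lambda>h. h \<bullet> f'' x)"
      unfolding gderiv_def by (rule has_derivative_unique)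
    have "h \<bullet> f' x = h \<bullet> f'' x" for h
      using fun_cong[OF eq] .
    then show "f' x = f'' x" by (subst vector_eq_ldot[symmetric]) simp
  qed
  with assms show ?thesis by simp
qed

text \<open>Gradients are unique, so membership in the closure yields convergence to any gradient that is
  known explicitly.\<close>

lemma C1_closure_limit:
  assumes "f \<in> C1_closure V" "has_C1_gradient f f'" shows "C1_limit V f f'"
  using assms C1_limit_unique unfolding C1_closure_def by blast

lemma C1_closure_add:
  assumes "\<And>f g. f \<in> V \<Longrightarrow> g \<in> V \<Longrightarrow> (\<lambda>x. f x + g x) \<in> V" "f \<in> C1_closure V" "g \<in> C1_closure V"
  shows "(\<lambda>x. f x + g x) \<in> C1_closure V"
  using C1_limit_add[OF assms(1)] assms(2,3) unfolding C1_closure_def by blast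

lemma C1_closure_scale:
  assumes "\<And>c f. f \<in> V \<Longrightarrow> (\<lambda>x. c * f x) \<in> V" "f \<in> C1_closure V"
  shows "(\<lambda>x. c * f x) \<in> C1_closure V"
  using C1_limit_scale[OF assms(1)] assms(2) unfolding C1_closure_def by blast

lemma C1_closure_sum:
  assumes V: "\<And>f g. f \<in> V \<Longrightarrow> g \<in> V \<Longrightarrow> (\<lambda>x. f x + g x) \<in> V" "(\<lambda>_. 0) \<in> V"
    and I: "finite I" "\<And>i. i \<in> I \<Longrightarrow> f i \<in> C1_closure V"
  shows "(\<lambda>x. \<Sum>i\<in>I. f i x) \<in> C1_closure V"
proof -
  define f' where "f' i = (SOME f'. C1_limit V (f i) f')" for i
  have f': "C1_limit V (f i) (f' i)" if "i \<in> I" for i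
    using I(2)[OF that] someI_ex[of "C1_limit V (f i)"] by (simp add: C1_closure_def f'_def)
  have "C1_limit V (\<lambda>x. \<Sum>i\<in>I. f i x) (\<lambda>x. \<Sum>i\<in>I. f' i x)"
    by (rule C1_limit_sum[OF V I(1) f'])
  then show ?thesis by (auto simp: C1_closure_def)
qed

section \<open>Polynomials as limits of ridge functions\<close>

text \<open>The mean value theorem turns the difference quotient into a value of the derivative at a point
  within \<open>h y\<close> of \<open>t\<close>, and the derivative is uniformly continuous on compact intervals.\<close>

lemma difference_quotient_uniform:
  fixes \<phi> \<phi>' :: "real \<Rightarrow> real"
  assumes der: "\<And>t. (\<phi> has_real_derivative \<phi>' t) (at t)" and cont: "continuous_on UNIV \<phi>'" and "e > 0"
  shows "\<exists>\<delta>>0. \<forall>t y h. \<bar>t\<bar> \<le> R \<longrightarrow> \<bar>y\<bar> \<le> R \<longrightarrow> 0 < h \<longrightarrow> h < \<delta> \<longrightarrow>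
    \<bar>\<phi>' (t + h * y) - \<phi>' t\<bar> \<le> e \<and> \<bar>(\<phi> (t + h * y) - \<phi> t) / h - y * \<phi>' t\<bar> \<le> e"
proof -
  \<comment> \<open>The bound \<open>M\<close> is positive even if \<open>R\<close> is not; the points \<open>t + h y\<close> stay in the ball of radius
    \<open>2 M\<close> for \<open>h \<le> 1\<close>.\<close>
  define M where "M = \<bar>R\<bar> + 1"
  have M: "M \<ge> 1" "R \<le> M" by (auto simp: M_def)
  have "uniformly_continuous_on (cball 0 (M + M)) \<phi>'"
    by (intro compact_uniformly_continuous continuous_on_subset[OF cont]) auto
  moreover have "e / M > 0" using M \<open>e > 0\<close> by simp
  ultimately obtain d where d: "d > 0"
    "\<And>s t. \<lbrakk>\<bar>s\<bar> \<le> M + M; \<bar>t\<bar> \<le> M + M; \<bar>s - t\<bar> < d\<rbrakk> \<Longrightarrow> \<bar>\<phi>' s - \<phi>' t\<bar> < e / M"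
    unfolding uniformly_continuous_on_def dist_real_def by (metis mem_cball_0 real_norm_def)
  define \<delta> where "\<delta> = min 1 (d / M)"
  have near: "\<bar>\<phi>' s - \<phi>' t\<bar> < e / M"
    if "\<bar>t\<bar> \<le> R" "\<bar>y\<bar> \<le> R" "0 < h" "h < \<delta>" "\<bar>s - t\<bar> \<le> \<bar>h * y\<bar>" for s t y h
  proof -
    have hy: "\<bar>h * y\<bar> = h * \<bar>y\<bar>" using that by (simp add: abs_mult)
    have "h * \<bar>y\<bar> \<le> 1 * M" using that M by (intro mult_mono) (auto simp: \<delta>_def)
    moreover have "h * \<bar>y\<bar> \<le> h * M" using that M by (intro mult_left_mono) auto
    moreover have "h * M < d" using that M by (auto simp: \<delta>_def field_simps)
    ultimately show ?thesis using that M hy by (intro d(2)) linarith+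
  qed
  have eM: "e / M \<le> e" using M \<open>e > 0\<close> by (simp add: field_simps)
  show ?thesis
  proof (intro exI[of _ \<delta>] conjI allI impI)
    show "\<delta> > 0" using d M by (simp add: \<delta>_def)
  next
    fix t y h assume *: "\<bar>t\<bar> \<le> R" "\<bar>y\<bar> \<le> R" "0 < h" "h < \<delta>"
    show "\<bar>\<phi>' (t + h * y) - \<phi>' t\<bar> \<le> e"
      using near[OF *, of "t + h * y"] eM by simp
  next
    fix t y h assume *: "\<bar>t\<bar> \<le> R" "\<bar>y\<bar> \<le> R" "0 < h" "h < \<delta>"
    show "\<bar>(\<phi> (t + h * y) - \<phi> t) / h - y * \<phi>' t\<bar> \<le> e"
    proof -
      have "\<exists>s. \<bar>s - t\<bar> \<le> \<bar>h * y\<bar> \<and> \<phi> (t + h * y) - \<phi> t = h * y * \<phi>' s"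
      proof (cases "h * y" "0::real" rule: linorder_cases)
        case less
        with MVT2[of "t + h * y" t \<phi> \<phi>'] der obtain z where
          "t + h * y < z" "z < t" "\<phi> t - \<phi> (t + h * y) = (t - (t + h * y)) * \<phi>' z" by auto
        with less show ?thesis by (intro exI[of _ z]) (auto simp: algebra_simps)
      next
        case greater
        with MVT2[of t "t + h * y" \<phi> \<phi>'] der obtain z where
          "t < z" "z < t + h * y" "\<phi> (t + h * y) - \<phi> t = (t + h * y - t) * \<phi>' z" by auto
        with greater show ?thesis by (intro exI[of _ z]) (auto simp: algebra_simps)
      qed auto
      then obtain s where s: "\<bar>s - t\<bar> \<le> \<bar>h * y\<bar>" "\<phi> (t + h * y) - \<phi> t = h * y * \<phi>' s" by blast
      have "\<bar>(\<phi> (t + h * y) - \<phi> t) / h - y * \<phi>' t\<bar> = \<bar>y\<bar> * \<bar>\<phi>' s - \<phi>' t\<bar>"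
        using * by (simp add: s(2) abs_mult[symmetric] algebra_simps)
      also have "\<dots> \<le> M * (e / M)"
        using near[OF * s(1)] * M by (intro mult_mono) auto
      finally show ?thesis using M by simp
    qed
  qed
qed

text \<open>By telescoping, \<open>\<Psi>(t + 1) - \<Psi>(t)\<close> is the mean of \<open>n + 1\<close> difference quotients of \<open>\<Psi>\<close> with
  step \<open>1/(n + 1)\<close>, and these are uniformly close to the values of \<open>\<psi>\<close> in the Riemann sum.\<close>

lemma riemann_sum_uniform:
  fixes \<psi> \<Psi> :: "real \<Rightarrow> real"
  assumes "\<And>t. (\<Psi> has_real_derivative \<psi> t) (at t)" "continuous_on UNIV \<psi>"
  shows "uniform_limit (cball 0 R) (\<lambda>n t. (\<Sum>j<Suc n. \<psi> (t + j / Suc n)) / Suc n)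
    (\<lambda>t. \<Psi> (t + 1) - \<Psi> t) sequentially"
proof (rule uniform_limitI)
  fix e :: real assume "e > 0"
  then have e2: "e/2 > 0" by simp
  obtain \<delta> where \<delta>: "\<delta> > 0"
    "\<And>t y h. \<lbrakk>\<bar>t\<bar> \<le> \<bar>R\<bar> + 1; \<bar>y\<bar> \<le> \<bar>R\<bar> + 1; 0 < h; h < \<delta>\<rbrakk> \<Longrightarrow> \<bar>(\<Psi> (t + h * y) - \<Psi> t) / h - y * \<psi> t\<bar> \<le> e/2"
    using difference_quotient_uniform[OF assms e2, where R = "\<bar>R\<bar> + 1"] by blast
  have "(\<lambda>n. 1 / real (Suc n)) \<longlonglongrightarrow> 0"
    using LIMSEQ_inverse_real_of_nat by (simp add: inverse_eq_divide)
  then have "\<forall>\<^sub>F n in sequentially. 1 / real (Suc n) < \<delta>"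
    by (rule order_tendstoD(2)) (rule \<delta>(1))
  then show "\<forall>\<^sub>F n in sequentially. \<forall>t\<in>cball 0 R.
      dist ((\<Sum>j<Suc n. \<psi> (t + j / Suc n)) / Suc n) (\<Psi> (t + 1) - \<Psi> t) < e"
  proof (rule eventually_mono, intro ballI)
    fix n t assume n: "1 / real (Suc n) < \<delta>" and t: "t \<in> cball (0::real) R"
    define h where "h = 1 / real (Suc n)"
    define s where "s j = t + real j * h" for j
    have h: "h > 0" "h * real (Suc n) = 1" by (simp_all add: h_def)
    have "\<Psi> (t + 1) - \<Psi> t = (\<Sum>j<Suc n. \<Psi> (s (Suc j)) - \<Psi> (s j))"
      using h by (subst sum_lessThan_telescope) (simp add: s_def mult.commute)
    moreover have "h * ((\<Psi> (s j + h * 1) - \<Psi> (s j)) / h - 1 * \<psi> (s j))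
        = (\<Psi> (s (Suc j)) - \<Psi> (s j)) - h * \<psi> (s j)" for j
      using h by (simp add: s_def algebra_simps diff_divide_distrib)
    ultimately have "\<bar>(\<Psi> (t + 1) - \<Psi> t) - h * (\<Sum>j<Suc n. \<psi> (s j))\<bar>
        = \<bar>\<Sum>j<Suc n. h * ((\<Psi> (s j + h * 1) - \<Psi> (s j)) / h - 1 * \<psi> (s j))\<bar>"
      by (simp only: sum_subtractf sum_distrib_left)
    also have "\<dots> \<le> (\<Sum>j<Suc n. h * (e/2))"
    proof (rule order_trans[OF sum_abs sum_mono])
      fix j assume "j \<in> {..<Suc n}"
      then have "real j * h \<le> real (Suc n) * h" using h by (intro mult_right_mono) auto
      also have "\<dots> = 1" using h(2) by (simp only: mult.commute)
      finally have "0 \<le> real j * h" "real j * h \<le> 1" using h(1) by simp_all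
      then have "\<bar>s j\<bar> \<le> \<bar>R\<bar> + 1" using t by (auto simp: s_def)
      then have "\<bar>(\<Psi> (s j + h * 1) - \<Psi> (s j)) / h - 1 * \<psi> (s j)\<bar> \<le> e/2"
        using n h by (intro \<delta>(2)) (auto simp: h_def)
      then show "\<bar>h * ((\<Psi> (s j + h * 1) - \<Psi> (s j)) / h - 1 * \<psi> (s j))\<bar> \<le> h * (e/2)"
        using h by (simp only: abs_mult) (intro mult_mono, auto)
    qed
    also have "\<dots> = e/2" using h by (simp add: algebra_simps del: of_nat_Suc)
    also have "h * (\<Sum>j<Suc n. \<psi> (s j)) = (\<Sum>j<Suc n. \<psi> (t + j / Suc n)) / Suc n"
      by (simp add: h_def s_def)
    finally show "dist ((\<Sum>j<Suc n. \<psi> (t + j / Suc n)) / Suc n) (\<Psi> (t + 1) - \<Psi> t) < e"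
      using \<open>e > 0\<close> by (simp only: dist_real_def abs_minus_commute)
  qed
qed

lemma antiderivative_exists:
  fixes \<psi> :: "real \<Rightarrow> real"
  assumes "continuous_on UNIV \<psi>"
  obtains \<Psi> where "\<And>t. (\<Psi> has_real_derivative \<psi> t) (at t)"
proof -
  have "\<exists>F. \<forall>x. -\<infinity> < ereal x \<longrightarrow> ereal x < \<infinity> \<longrightarrow> (F has_vector_derivative \<psi> x) (at x)"
    by (rule einterval_antiderivative) (use assms in \<open>auto simp: continuous_on_eq_continuous_at\<close>)
  then show ?thesis using that by (auto simp: has_real_derivative_iff_has_vector_derivative)
qed

definition is_C1 :: "(real \<Rightarrow> real) \<Rightarrow> bool" where
  "is_C1 \<psi> \<longleftrightarrow> (\<exists>\<psi>'. (\<forall>t. (\<psi> has_real_derivative \<psi>' t) (at t)) \<and> continuous_on UNIV \<psi>')"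

lemma is_C1_continuous: "is_C1 \<psi> \<Longrightarrow> continuous_on UNIV \<psi>"
  unfolding is_C1_def by (meson DERIV_isCont continuous_at_imp_continuous_on)

definition unit_difference :: "(real \<Rightarrow> real) \<Rightarrow> real \<Rightarrow> real" where
  "unit_difference \<psi> t = \<psi> (t + 1) - \<psi> t"

lemma derivative_unit_difference:
  assumes "\<And>t. (\<psi> has_real_derivative \<psi>' t) (at t)"
  shows "(unit_difference \<psi> has_real_derivative unit_difference \<psi>' t) (at t)"
  unfolding unit_difference_def
  by (auto intro!: derivative_eq_intros DERIV_chain2[where f = \<psi>] assms)

lemma continuous_unit_difference:
  assumes "continuous_on UNIV \<psi>" shows "continuous_on UNIV (unit_difference \<psi>)"
  unfolding unit_difference_def
  by (intro continuous_intros continuous_on_compose2[OF assms]) auto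

lemma is_C1_unit_difference: "is_C1 \<psi> \<Longrightarrow> is_C1 (unit_difference \<psi>)"
  unfolding is_C1_def using derivative_unit_difference continuous_unit_difference by blast

lemma has_C1_gradient_times_ridge:
  fixes a :: "'a::euclidean_space"
  assumes "has_C1_gradient m m'"
    and "\<And>t. (\<phi> has_real_derivative \<phi>' t) (at t)" "continuous_on UNIV \<phi>'"
  shows "has_C1_gradient (\<lambda>x. m x * \<phi> (a \<bullet> x + b))
    (\<lambda>x. m x *\<^sub>R (\<phi>' (a \<bullet> x + b) *\<^sub>R a) + \<phi> (a \<bullet> x + b) *\<^sub>R m' x)"
  by (intro has_C1_gradient_mult has_C1_gradient_ridge assms)

lemma bounded_image_cball:
  fixes h :: "'a::euclidean_space \<Rightarrow> 'b::real_normed_vector"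
  assumes "continuous_on UNIV h" shows "bounded (h ` cball 0 R)"
  by (intro compact_imp_bounded compact_continuous_image continuous_on_subset[OF assms]) auto

lemma inner_affine_bound:
  fixes a x :: "'a::euclidean_space"
  assumes "norm x \<le> R" shows "\<bar>a \<bullet> x + b\<bar> \<le> norm a * R + \<bar>b\<bar>"
  using Cauchy_Schwarz_ineq2[of a x] mult_left_mono[OF assms norm_ge_zero[of a]] by linarith

lemma C1_closure_ridge_limit:
  fixes a :: "'a::euclidean_space"
  assumes m: "has_C1_gradient m m'"
    and \<phi>: "\<And>t. (\<phi> has_real_derivative \<phi>' t) (at t)" "continuous_on UNIV \<phi>'"
    and p: "\<And>n t. (p n has_real_derivative p' n t) (at t)" "\<And>n. continuous_on UNIV (p' n)"
    and cl: "\<And>n::nat. (\<lambda>x. m x * p n (a \<bullet> x + b)) \<in> C1_closure V"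
    and lim: "\<And>R. uniform_limit (cball 0 R) p \<phi> sequentially"
      "\<And>R. uniform_limit (cball 0 R) p' \<phi>' sequentially"
  shows "(\<lambda>x. m x * \<phi> (a \<bullet> x + b)) \<in> C1_closure V"
proof -
  have "C1_limit V (\<lambda>x. m x * \<phi> (a \<bullet> x + b))
    (\<lambda>x. m x *\<^sub>R (\<phi>' (a \<bullet> x + b) *\<^sub>R a) + \<phi> (a \<bullet> x + b) *\<^sub>R m' x)"
  proof (rule C1_limit_of_C1_limits[OF has_C1_gradient_times_ridge[OF m \<phi>]])
    fix R :: real
    have n: "C1_limit V (\<lambda>x. m x * p n (a \<bullet> x + b))
        (\<lambda>x. m x *\<^sub>R (p' n (a \<bullet> x + b) *\<^sub>R a) + p n (a \<bullet> x + b) *\<^sub>R m' x)" for n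
      by (rule C1_closure_limit[OF cl has_C1_gradient_times_ridge[OF m p]])
    have sub: "(\<lambda>x. a \<bullet> x + b) \<in> cball 0 R \<rightarrow> cball 0 (norm a * R + \<bar>b\<bar>)"
      using inner_affine_bound[of _ R a b] by auto
    have ul: "uniform_limit (cball 0 R) (\<lambda>n x. p n (a \<bullet> x + b)) (\<lambda>x. \<phi> (a \<bullet> x + b)) sequentially"
      "uniform_limit (cball 0 R) (\<lambda>n x. p' n (a \<bullet> x + b)) (\<lambda>x. \<phi>' (a \<bullet> x + b)) sequentially"
      by (rule uniform_limit_compose'[OF lim(1) sub], rule uniform_limit_compose'[OF lim(2) sub])
    have \<phi>c: "continuous_on UNIV \<phi>"
      using \<phi>(1) by (meson DERIV_isCont continuous_at_imp_continuous_on)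
    have b: "bounded (m ` cball 0 R)" "bounded (m' ` cball 0 R)"
      "bounded ((\<lambda>x. \<phi> (a \<bullet> x + b)) ` cball 0 R)" "bounded ((\<lambda>x. \<phi>' (a \<bullet> x + b) *\<^sub>R a) ` cball 0 R)"
      using m by (auto intro!: bounded_image_cball has_C1_gradient_continuous[OF m] continuous_intros
        continuous_on_compose2[OF \<phi>c] continuous_on_compose2[OF \<phi>(2)] simp: has_C1_gradient_def)
    show "\<exists>g g'. (\<forall>n::nat. C1_limit V (g n) (g' n)) \<and>
      uniform_limit (cball 0 R) g (\<lambda>x. m x * \<phi> (a \<bullet> x + b)) sequentially \<and>
      uniform_limit (cball 0 R) g' (\<lambda>x. m x *\<^sub>R (\<phi>' (a \<bullet> x + b) *\<^sub>R a) + \<phi> (a \<bullet> x + b) *\<^sub>R m' x) sequentially"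
      by (rule exI[of _ "\<lambda>n x. m x * p n (a \<bullet> x + b)"],
          rule exI[of _ "\<lambda>n x. m x *\<^sub>R (p' n (a \<bullet> x + b) *\<^sub>R a) + p n (a \<bullet> x + b) *\<^sub>R m' x"])
        (intro conjI allI n uniform_limit_intros ul b
          bounded_linear.uniform_limit[OF bounded_linear_scaleR_left])
  qed
  then show ?thesis by (auto simp: C1_closure_def)
qed

text \<open>The directional derivative of \<open>\<phi>(a \<bullet> x + b)\<close> with respect to \<open>a\<close> in direction \<open>v\<close> is
  \<open>(v \<bullet> x) \<phi>'(a \<bullet> x + b)\<close>. Its difference quotients are combinations of two ridge functions,
  and they converge in \<open>C\<^sup>1\<close> when \<open>\<phi>\<close> is twice continuously differentiable.\<close>

lemma C1_closure_shift_derivative: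
  fixes m :: "'a::euclidean_space \<Rightarrow> real"
  assumes V: "\<And>f g. f \<in> V \<Longrightarrow> g \<in> V \<Longrightarrow> (\<lambda>x. f x + g x) \<in> V" "\<And>c f. f \<in> V \<Longrightarrow> (\<lambda>x. c * f x) \<in> V"
    and m: "has_C1_gradient m m'"
    and \<phi>: "\<And>t. (\<phi> has_real_derivative \<phi>' t) (at t)" "\<And>t. (\<phi>' has_real_derivative \<phi>'' t) (at t)"
      "continuous_on UNIV \<phi>''"
    and cl: "\<And>a b. (\<lambda>x. m x * \<phi> (a \<bullet> x + b)) \<in> C1_closure V"
  shows "(\<lambda>x. ((v \<bullet> x) * m x) * \<phi>' (a \<bullet> x + b)) \<in> C1_closure V"
proof -
  define h where "h n = 1 / real (Suc n)" for n
  have h: "h n > 0" "h \<longlonglongrightarrow> 0" for n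
    using LIMSEQ_inverse_real_of_nat by (auto simp: h_def[abs_def] inverse_eq_divide)
  have \<phi>'c: "continuous_on UNIV \<phi>'"
    using \<phi>(2) by (meson DERIV_isCont continuous_at_imp_continuous_on)
  have \<phi>c: "continuous_on UNIV \<phi>"
    using \<phi>(1) by (meson DERIV_isCont continuous_at_imp_continuous_on)
  define t where "t x = a \<bullet> x + b" for x
  have ht: "(a + c *\<^sub>R v) \<bullet> x + b = t x + c * (v \<bullet> x)" for c x
    by (simp add: t_def inner_add_left)
  have tc: "continuous_on UNIV t" by (auto simp: t_def intro!: continuous_intros)
  define q where "q n x = m x * ((\<phi> (t x + h n * (v \<bullet> x)) - \<phi> (t x)) / h n)" for n x
  define q' where "q' n x = m x *\<^sub>R (((\<phi>' (t x + h n * (v \<bullet> x)) - \<phi>' (t x)) / h n) *\<^sub>R a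
      + \<phi>' (t x + h n * (v \<bullet> x)) *\<^sub>R v) + ((\<phi> (t x + h n * (v \<bullet> x)) - \<phi> (t x)) / h n) *\<^sub>R m' x" for n x
  have q: "C1_limit V (q n) (q' n)" for n
  proof -
    have 1: "C1_limit V (\<lambda>x. m x * \<phi> (c \<bullet> x + b))
        (\<lambda>x. m x *\<^sub>R (\<phi>' (c \<bullet> x + b) *\<^sub>R c) + \<phi> (c \<bullet> x + b) *\<^sub>R m' x)" for c
      by (rule C1_closure_limit[OF cl has_C1_gradient_times_ridge[OF m \<phi>(1) \<phi>'c]])
    have "C1_limit V
        (\<lambda>x. 1 / h n * (m x * \<phi> ((a + h n *\<^sub>R v) \<bullet> x + b)) + (- 1 / h n) * (m x * \<phi> (a \<bullet> x + b)))
        (\<lambda>x. (1 / h n) *\<^sub>R (m x *\<^sub>R (\<phi>' ((a + h n *\<^sub>R v) \<bullet> x + b) *\<^sub>R (a + h n *\<^sub>R v))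
              + \<phi> ((a + h n *\<^sub>R v) \<bullet> x + b) *\<^sub>R m' x)
            + (- 1 / h n) *\<^sub>R (m x *\<^sub>R (\<phi>' (a \<bullet> x + b) *\<^sub>R a) + \<phi> (a \<bullet> x + b) *\<^sub>R m' x))"
      by (intro C1_limit_add C1_limit_scale V 1)
    moreover have "(\<lambda>x. 1 / h n * (m x * \<phi> ((a + h n *\<^sub>R v) \<bullet> x + b)) + (- 1 / h n) * (m x * \<phi> (a \<bullet> x + b))) = q n"
      using h(1)[of n] unfolding ht t_def[symmetric] by (auto simp: q_def fun_eq_iff field_simps)
    moreover have "(\<lambda>x. (1 / h n) *\<^sub>R (m x *\<^sub>R (\<phi>' ((a + h n *\<^sub>R v) \<bullet> x + b) *\<^sub>R (a + h n *\<^sub>R v))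
              + \<phi> ((a + h n *\<^sub>R v) \<bullet> x + b) *\<^sub>R m' x)
            + (- 1 / h n) *\<^sub>R (m x *\<^sub>R (\<phi>' (a \<bullet> x + b) *\<^sub>R a) + \<phi> (a \<bullet> x + b) *\<^sub>R m' x)) = q' n"
      using h(1)[of n] unfolding ht t_def[symmetric]
      by (auto simp: q'_def fun_eq_iff algebra_simps diff_divide_distrib)
    ultimately show ?thesis by simp
  qed
  have quot: "uniform_limit (cball 0 R) (\<lambda>n x. (f (t x + h n * (v \<bullet> x)) - f (t x)) / h n)
        (\<lambda>x. (v \<bullet> x) * f' (t x)) sequentially"
      "uniform_limit (cball 0 R) (\<lambda>n x. f' (t x + h n * (v \<bullet> x))) (\<lambda>x. f' (t x)) sequentially"
    if f: "\<And>t. (f has_real_derivative f' t) (at t)" "continuous_on UNIV f'" for f f' R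
  proof -
    define M where "M = max (norm a * R + \<bar>b\<bar>) (norm v * R + \<bar>0\<bar>)"
    have M: "\<bar>t x\<bar> \<le> M" "\<bar>v \<bullet> x\<bar> \<le> M" if "norm x \<le> R" for x
      using inner_affine_bound[OF that, of a b] inner_affine_bound[OF that, of v 0]
      by (auto simp: M_def t_def)
    have *: "\<forall>\<^sub>F n in sequentially. \<forall>x\<in>cball 0 R. \<bar>f' (t x + h n * (v \<bullet> x)) - f' (t x)\<bar> < e \<and>
        \<bar>(f (t x + h n * (v \<bullet> x)) - f (t x)) / h n - (v \<bullet> x) * f' (t x)\<bar> < e" if "e > 0" for e
    proof -
      have "e/2 > 0" using that by simp
      then obtain \<delta> where \<delta>: "\<delta> > 0" "\<forall>t y h. \<bar>t\<bar> \<le> M \<longrightarrow> \<bar>y\<bar> \<le> M \<longrightarrow> 0 < h \<longrightarrow> h < \<delta> \<longrightarrow>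
          \<bar>f' (t + h * y) - f' t\<bar> \<le> e/2 \<and> \<bar>(f (t + h * y) - f t) / h - y * f' t\<bar> \<le> e/2"
        using difference_quotient_uniform[OF f, of "e/2" M] by blast
      have "\<forall>\<^sub>F n in sequentially. h n < \<delta>"
        by (rule order_tendstoD(2)[OF h(2) \<delta>(1)])
      then show ?thesis
      proof (rule eventually_mono, intro ballI)
        fix n x assume "h n < \<delta>" "x \<in> cball (0::'a) R"
        then have "\<bar>f' (t x + h n * (v \<bullet> x)) - f' (t x)\<bar> \<le> e/2 \<and>
          \<bar>(f (t x + h n * (v \<bullet> x)) - f (t x)) / h n - (v \<bullet> x) * f' (t x)\<bar> \<le> e/2"
          using \<delta>(2) M h(1) by simp
        with that show "\<bar>f' (t x + h n * (v \<bullet> x)) - f' (t x)\<bar> < e \<and>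
          \<bar>(f (t x + h n * (v \<bullet> x)) - f (t x)) / h n - (v \<bullet> x) * f' (t x)\<bar> < e" by linarith
      qed
    qed
    show "uniform_limit (cball 0 R) (\<lambda>n x. (f (t x + h n * (v \<bullet> x)) - f (t x)) / h n)
        (\<lambda>x. (v \<bullet> x) * f' (t x)) sequentially"
      by (rule uniform_limitI, rule eventually_mono[OF *]) (auto simp: dist_real_def)
    show "uniform_limit (cball 0 R) (\<lambda>n x. f' (t x + h n * (v \<bullet> x))) (\<lambda>x. f' (t x)) sequentially"
      by (rule uniform_limitI, rule eventually_mono[OF *]) (auto simp: dist_real_def)
  qed
  define g' where "g' x = m x *\<^sub>R (((v \<bullet> x) * \<phi>'' (t x)) *\<^sub>R a + \<phi>' (t x) *\<^sub>R v)
      + ((v \<bullet> x) * \<phi>' (t x)) *\<^sub>R m' x" for x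
  have "C1_limit V (\<lambda>x. m x * ((v \<bullet> x) * \<phi>' (t x))) g'"
  proof (rule C1_limit_of_C1_limits)
    have "has_C1_gradient (\<lambda>x. m x * ((v \<bullet> x + 0) * \<phi>' (a \<bullet> x + b)))
      (\<lambda>x. m x *\<^sub>R ((v \<bullet> x + 0) *\<^sub>R \<phi>'' (a \<bullet> x + b) *\<^sub>R a + \<phi>' (a \<bullet> x + b) *\<^sub>R (1 *\<^sub>R v))
          + ((v \<bullet> x + 0) * \<phi>' (a \<bullet> x + b)) *\<^sub>R m' x)"
      by (intro has_C1_gradient_mult m has_C1_gradient_ridge[OF \<phi>(2,3)]
          has_C1_gradient_ridge[where \<phi> = "\<lambda>x. x" and \<phi>' = "\<lambda>x. 1"]) (auto intro!: derivative_eq_intros)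
    then show "has_C1_gradient (\<lambda>x. m x * ((v \<bullet> x) * \<phi>' (t x))) g'"
      unfolding g'_def t_def by simp
    fix R :: real
    have b: "bounded (m ` cball 0 R)" "bounded (m' ` cball 0 R)"
      "bounded ((\<lambda>x. (v \<bullet> x) * \<phi>' (t x)) ` cball 0 R)"
      "bounded ((\<lambda>x. ((v \<bullet> x) * \<phi>'' (t x)) *\<^sub>R a + \<phi>' (t x) *\<^sub>R v) ` cball 0 R)"
      using m by (auto intro!: bounded_image_cball has_C1_gradient_continuous[OF m] continuous_intros
        continuous_on_compose2[OF \<phi>'c tc] continuous_on_compose2[OF \<phi>(3) tc] simp: has_C1_gradient_def)
    have "uniform_limit (cball 0 R) q (\<lambda>x. m x * ((v \<bullet> x) * \<phi>' (t x))) sequentially"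
      unfolding q_def by (intro uniform_limit_intros quot(1)[OF \<phi>(1) \<phi>'c] quot(2)[OF \<phi>(1) \<phi>'c] quot[OF \<phi>(2,3)] b)
    moreover have "uniform_limit (cball 0 R) q' g' sequentially"
      unfolding q'_def g'_def
      by (intro uniform_limit_intros quot(1)[OF \<phi>(1) \<phi>'c] quot(2)[OF \<phi>(1) \<phi>'c] quot[OF \<phi>(2,3)] b bounded_linear.uniform_limit[OF bounded_linear_scaleR_left])
    ultimately show "\<exists>g g'a. (\<forall>n::nat. C1_limit V (g n) (g'a n)) \<and>
      uniform_limit (cball 0 R) g (\<lambda>x. m x * ((v \<bullet> x) * \<phi>' (t x))) sequentially \<and>
      uniform_limit (cball 0 R) g'a g' sequentially"
      using q by blast
  qed
  moreover have "(\<lambda>x. ((v \<bullet> x) * m x) * \<phi>' (a \<bullet> x + b)) = (\<lambda>x. m x * ((v \<bullet> x) * \<phi>' (t x)))"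
    by (auto simp: t_def)
  ultimately show ?thesis by (auto simp: C1_closure_def)
qed

text \<open>If \<open>\<Psi>' = \<psi>\<close>, then \<open>\<Psi>(t + 1) - \<Psi>(t)\<close> is the average of \<open>\<psi>\<close> over \<open>[t, t + 1]\<close>. It is a
  limit of Riemann sums of translates of \<open>\<psi>\<close>, and it has one more derivative than \<open>\<psi>\<close>, so that
  differentiating it in the weight is possible; its derivative is the difference of \<open>\<psi>\<close>. The factor
  gained is \<open>v \<bullet> x\<close>, and the difference is again \<open>C\<^sup>1\<close>, so the step can be repeated.\<close>

lemma C1_closure_unit_difference:
  fixes m :: "'a::euclidean_space \<Rightarrow> real"
  assumes V: "\<And>f g. f \<in> V \<Longrightarrow> g \<in> V \<Longrightarrow> (\<lambda>x. f x + g x) \<in> V" "\<And>c f. f \<in> V \<Longrightarrow> (\<lambda>x. c * f x) \<in> V"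
      "(\<lambda>_. 0) \<in> V"
    and m: "has_C1_gradient m m'" and \<psi>: "is_C1 \<psi>"
    and cl: "\<And>a b. (\<lambda>x. m x * \<psi> (a \<bullet> x + b)) \<in> C1_closure V"
  shows "(\<lambda>x. ((v \<bullet> x) * m x) * unit_difference \<psi> (a \<bullet> x + b)) \<in> C1_closure V"
proof -
  obtain \<psi>' where \<psi>': "\<And>t. (\<psi> has_real_derivative \<psi>' t) (at t)" "continuous_on UNIV \<psi>'"
    using \<psi> by (auto simp: is_C1_def)
  obtain \<Psi> where \<Psi>: "\<And>t. (\<Psi> has_real_derivative \<psi> t) (at t)"
    using antiderivative_exists[OF is_C1_continuous[OF \<psi>]] by blast
  have cl\<Psi>: "(\<lambda>x. m x * unit_difference \<Psi> (a \<bullet> x + b)) \<in> C1_closure V" for a b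
  proof (rule C1_closure_ridge_limit[OF m])
    show "(unit_difference \<Psi> has_real_derivative unit_difference \<psi> t) (at t)" for t
      by (rule derivative_unit_difference[OF \<Psi>])
    show "continuous_on UNIV (unit_difference \<psi>)"
      by (rule continuous_unit_difference[OF is_C1_continuous[OF \<psi>]])
    show "((\<lambda>t. (\<Sum>j<Suc n. \<psi> (t + j / Suc n)) / Suc n) has_real_derivative
        (\<Sum>j<Suc n. \<psi>' (t + j / Suc n)) / Suc n) (at t)" for n t
      by (rule DERIV_cdivide, rule DERIV_sum, rule iffD1[OF DERIV_shift], rule \<psi>')
    show "continuous_on UNIV (\<lambda>t. (\<Sum>j<Suc n. \<psi>' (t + j / Suc n)) / Suc n)" for n
      by (intro continuous_intros continuous_on_compose2[OF \<psi>'(2)]) auto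
    show "uniform_limit (cball 0 R) (\<lambda>n t. (\<Sum>j<Suc n. \<psi> (t + j / Suc n)) / Suc n)
        (unit_difference \<Psi>) sequentially" for R
      using riemann_sum_uniform[OF \<Psi> is_C1_continuous[OF \<psi>]] by (simp add: unit_difference_def[abs_def])
    show "uniform_limit (cball 0 R) (\<lambda>n t. (\<Sum>j<Suc n. \<psi>' (t + j / Suc n)) / Suc n)
        (unit_difference \<psi>) sequentially" for R
      using riemann_sum_uniform[OF \<psi>'] by (simp add: unit_difference_def[abs_def])
    fix n :: nat
    have "(\<lambda>x. 1 / Suc n * (\<Sum>j<Suc n. m x * \<psi> (a \<bullet> x + (b + j / Suc n)))) \<in> C1_closure V"
      by (intro C1_closure_scale C1_closure_sum V cl) auto
    then show "(\<lambda>x. m x * ((\<Sum>j<Suc n. \<psi> (a \<bullet> x + b + j / Suc n)) / Suc n)) \<in> C1_closure V"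
      by (simp add: sum_distrib_left sum_divide_distrib add.assoc del: sum.lessThan_Suc)
  qed
  show ?thesis
    by (rule C1_closure_shift_derivative[OF V(1,2) m derivative_unit_difference[OF \<Psi>]
        derivative_unit_difference[OF \<psi>'(1)] continuous_unit_difference[OF \<psi>'(2)] cl\<Psi>])
qed

definition monomial :: "'a::euclidean_space list \<Rightarrow> 'a \<Rightarrow> real" where
  "monomial vs x = (\<Prod>v\<leftarrow>vs. v \<bullet> x)"

lemma has_C1_gradient_monomial: "\<exists>m'. has_C1_gradient (monomial vs) m'"
proof (induction vs)
  case Nil
  show ?case using has_C1_gradient_const[of 1] by (auto simp: monomial_def[abs_def])
next
  case (Cons v vs)
  then obtain m' where m': "has_C1_gradient (monomial vs) m'" by blast
  have v: "has_C1_gradient (\<lambda>x. v \<bullet> x + 0) (\<lambda>x. 1 *\<^sub>R v)"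
    by (rule has_C1_gradient_ridge[where \<phi> = "\<lambda>x. x" and \<phi>' = "\<lambda>x. 1"]) (auto intro!: derivative_eq_intros)
  have "monomial (v # vs) = (\<lambda>x. (v \<bullet> x + 0) * monomial vs x)"
    by (auto simp: monomial_def)
  with has_C1_gradient_mult[OF v m'] show ?case by auto
qed

lemma is_C1_unit_difference_power: "is_C1 \<psi> \<Longrightarrow> is_C1 ((unit_difference ^^ k) \<psi>)"
  by (induction k) (auto intro: is_C1_unit_difference)

lemma monomial_times_difference_in_C1_closure:
  fixes V :: "('a::euclidean_space \<Rightarrow> real) set"
  assumes V: "\<And>f g. f \<in> V \<Longrightarrow> g \<in> V \<Longrightarrow> (\<lambda>x. f x + g x) \<in> V" "\<And>c f. f \<in> V \<Longrightarrow> (\<lambda>x. c * f x) \<in> V"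
      "(\<lambda>_. 0) \<in> V"
    and \<sigma>: "is_C1 \<sigma>" and ridge: "\<And>a b. (\<lambda>x. \<sigma> (a \<bullet> x + b)) \<in> V"
  shows "(\<lambda>x. monomial vs x * (unit_difference ^^ length vs) \<sigma> (a \<bullet> x + b)) \<in> C1_closure V"
proof (induction vs arbitrary: a b)
  case Nil
  obtain \<sigma>' where "\<And>t. (\<sigma> has_real_derivative \<sigma>' t) (at t)" "continuous_on UNIV \<sigma>'"
    using \<sigma> by (auto simp: is_C1_def)
  from C1_limit_self[OF ridge has_C1_gradient_ridge[OF this]]
  show ?case by (auto simp: monomial_def C1_closure_def)
next
  case (Cons v vs)
  obtain m' where m': "has_C1_gradient (monomial vs) m'"
    using has_C1_gradient_monomial by blast
  have "(\<lambda>x. ((v \<bullet> x) * monomial vs x) * unit_difference ((unit_difference ^^ length vs) \<sigma>) (a \<bullet> x + b))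
      \<in> C1_closure V"
    by (rule C1_closure_unit_difference[OF V m' is_C1_unit_difference_power[OF \<sigma>] Cons.IH])
  then show ?case by (simp add: monomial_def)
qed

text \<open>Taking zero for the inner weight and for the bias a point where the iterated difference does not
  vanish shows that all products of linear forms belong to the closure. These span the polynomials;
  the spanning argument is an induction on polynomials that carries an arbitrary cofactor \<open>q\<close> along,
  since the closure is not known to be closed under products.\<close>

lemma polynomial_in_C1_closure:
  fixes V :: "('a::euclidean_space \<Rightarrow> real) set"
  assumes V: "\<And>f g. f \<in> V \<Longrightarrow> g \<in> V \<Longrightarrow> (\<lambda>x. f x + g x) \<in> V" "\<And>c f. f \<in> V \<Longrightarrow> (\<lambda>x. c * f x) \<in> V"
      "(\<lambda>_. 0) \<in> V"
    and \<sigma>: "is_C1 \<sigma>" and ridge: "\<And>a b. (\<lambda>x. \<sigma> (a \<bullet> x + b)) \<in> V"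
    and nz: "\<And>k. (unit_difference ^^ k) \<sigma> \<noteq> (\<lambda>_. 0)"
    and p: "real_polynomial_function p"
  shows "p \<in> C1_closure V"
proof -
  have mono: "monomial vs \<in> C1_closure V" for vs
  proof -
    obtain b where b: "(unit_difference ^^ length vs) \<sigma> b \<noteq> 0"
      using nz[of "length vs"] by (auto simp: fun_eq_iff)
    have "(\<lambda>x. 1 / (unit_difference ^^ length vs) \<sigma> b *
        (monomial vs x * (unit_difference ^^ length vs) \<sigma> (0 \<bullet> x + b))) \<in> C1_closure V"
      by (rule C1_closure_scale[OF V(2) monomial_times_difference_in_C1_closure[OF V \<sigma> ridge]])
    with b show ?thesis by simp
  qed
  have gen: "(\<lambda>x. p x * q x * monomial vs x) \<in> C1_closure V"
    if "\<And>vs. (\<lambda>x. q x * monomial vs x) \<in> C1_closure V" for q vs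
    using p that
  proof (induction arbitrary: q vs)
    case (linear f)
    have "f x = adjoint f 1 \<bullet> x" for x
      using adjoint_works[OF bounded_linear.linear[OF linear.hyps], of x 1] by (simp add: inner_commute)
    then have "(\<lambda>x. f x * q x * monomial vs x) = (\<lambda>x. q x * monomial (adjoint f 1 # vs) x)"
      by (simp add: monomial_def fun_eq_iff)
    then show ?case using linear.prems by simp
  next
    case (const c)
    from C1_closure_scale[OF V(2) const, of c vs] show ?case by (simp add: mult.assoc)
  next
    case (add f g)
    have "(\<lambda>x. f x * q x * monomial vs x + g x * q x * monomial vs x) \<in> C1_closure V"
      by (rule C1_closure_add[OF V(1) add.IH(1)[OF add.prems] add.IH(2)[OF add.prems]])
    then show ?case by (simp only: distrib_right)
  next
    case (mult f g)
    have "(\<lambda>x. f x * (g x * q x) * monomial vs x) \<in> C1_closure V"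
      by (rule mult.IH(1)[OF mult.IH(2)[OF mult.prems]])
    then show ?case by (simp add: mult.assoc)
  qed
  have "(\<lambda>x. p x * 1 * monomial [] x) \<in> C1_closure V"
    by (rule gen) (simp add: mono)
  then show ?thesis by (simp add: monomial_def)
qed

section \<open>Iterated differences of a square integrable function\<close>

text \<open>For an interval of length at most one the translates by natural numbers are disjoint, so the
  integral of \<open>\<Sum>\<^sub>n \<sigma>(t + n)\<^sup>2\<close> over it is bounded by the integral of \<open>\<sigma>\<^sup>2\<close>. Hence the
  series is finite for almost every \<open>t\<close>, and its terms tend to zero.\<close>

lemma exists_shifts_tendsto_zero:
  fixes \<sigma> :: "real \<Rightarrow> real"
  assumes cont: "continuous_on UNIV \<sigma>" and L2: "square_integrable_on \<sigma> UNIV" and "a < b"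
  shows "\<exists>t. a < t \<and> t < b \<and> (\<lambda>n. \<sigma> (t + real n)) \<longlonglongrightarrow> 0"
proof -
  \<comment> \<open>Shrink the interval to length at most one to make its integer translates disjoint.\<close>
  define c where "c = min b (a + 1)"
  have c: "a < c" "c \<le> b" "c \<le> a + 1" using \<open>a < b\<close> by (auto simp: c_def)
  have meas: "\<sigma> \<in> borel_measurable borel"
    using cont by (rule borel_measurable_continuous_onI)
  define g where "g n t = ennreal ((\<sigma> (t + real n))\<^sup>2) * indicator {a<..<c} t" for n t
  have gm: "g n \<in> borel_measurable lborel" for n
    unfolding g_def using meas by measurable
  have "(\<integral>\<^sup>+t. (\<Sum>n. g n t) \<partial>lborel) = (\<Sum>n. \<integral>\<^sup>+t. g n t \<partial>lborel)"
    by (rule nn_integral_suminf[OF gm])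
  also have "\<dots> = (\<Sum>n. \<integral>\<^sup>+t. ennreal ((\<sigma> t)\<^sup>2) * indicator {a + real n<..<c + real n} t \<partial>lborel)"
  proof (rule suminf_cong)
    fix n
    have "(\<integral>\<^sup>+t. ennreal ((\<sigma> t)\<^sup>2) * indicator {a + real n<..<c + real n} t \<partial>lborel)
      = ennreal \<bar>1\<bar> * (\<integral>\<^sup>+t. ennreal ((\<sigma> (real n + 1 * t))\<^sup>2) * indicator {a + real n<..<c + real n} (real n + 1 * t) \<partial>lborel)"
      by (rule nn_integral_real_affine) (use meas in auto)
    also have "\<dots> = (\<integral>\<^sup>+t. g n t \<partial>lborel)"
      by (simp add: g_def indicator_def add.commute)
    finally show "(\<integral>\<^sup>+t. g n t \<partial>lborel) = (\<integral>\<^sup>+t. ennreal ((\<sigma> t)\<^sup>2) * indicator {a + real n<..<c + real n} t \<partial>lborel)" ..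
  qed
  also have "\<dots> = (\<integral>\<^sup>+t. (\<Sum>n. ennreal ((\<sigma> t)\<^sup>2) * indicator {a + real n<..<c + real n} t) \<partial>lborel)"
    by (rule nn_integral_suminf[symmetric]) (use meas in measurable)
  also have "\<dots> \<le> (\<integral>\<^sup>+t. ennreal ((\<sigma> t)\<^sup>2) \<partial>lborel)"
  proof (rule nn_integral_mono)
    fix t
    have "(\<Sum>n. indicator {a + real n<..<c + real n} t :: ennreal) = indicator (\<Union>n. {a + real n<..<c + real n}) t"
    proof (rule suminf_indicator)
      have "n = k" if "x \<in> {a + real n<..<c + real n}" "x \<in> {a + real k<..<c + real k}" for x n k
      proof -
        have "\<bar>real n - real k\<bar> < 1" using that c by auto
        then show ?thesis by linarith
      qed
      then show "disjoint_family (\<lambda>n. {a + real n<..<c + real n})"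
        unfolding disjoint_family_on_def by blast
    qed
    then show "(\<Sum>n. ennreal ((\<sigma> t)\<^sup>2) * indicator {a + real n<..<c + real n} t) \<le> ennreal ((\<sigma> t)\<^sup>2)"
      by (simp add: ennreal_suminf_cmult indicator_def)
  qed
  also have "\<dots> < \<infinity>"
  proof -
    have "integrable lebesgue (\<lambda>x. (norm (\<sigma> x))\<^sup>2)"
      using L2 by (simp add: square_integrable_on_def set_integrable_def)
    then have "(\<integral>\<^sup>+t. ennreal ((\<sigma> t)\<^sup>2) \<partial>lebesgue) < \<infinity>"
      by (simp add: integrable_iff_bounded)
    then show ?thesis using meas by (subst (asm) nn_integral_completion) auto
  qed
  finally have "AE t in lborel. (\<Sum>n. g n t) \<noteq> \<infinity>"
    by (intro nn_integral_PInf_AE borel_measurable_suminf_order gm) auto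
  then have AE: "AE t in lborel. (\<Sum>n. g n t) \<noteq> \<infinity>" .
  have "\<exists>t\<in>{a<..<c}. (\<Sum>n. g n t) \<noteq> \<infinity>"
  proof (rule ccontr)
    assume "\<not> ?thesis"
    with AE have "AE t in lborel. t \<notin> {a<..<c}"
      by (auto elim!: eventually_mono)
    then have "emeasure lborel {a<..<c} = 0"
      by (subst (asm) AE_iff_measurable[where N = "{a<..<c}"]) auto
    with c show False by simp
  qed
  then obtain t where t: "a < t" "t < c" "(\<Sum>n. g n t) \<noteq> \<infinity>" by auto
  then have "(\<Sum>n. ennreal ((\<sigma> (t + real n))\<^sup>2)) \<noteq> \<infinity>"
    by (simp add: g_def)
  then have "summable (\<lambda>n. (\<sigma> (t + real n))\<^sup>2)"
    by (intro summable_suminf_not_top) auto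
  then have "(\<lambda>n. (\<sigma> (t + real n))\<^sup>2) \<longlonglongrightarrow> 0" by (rule summable_LIMSEQ_zero)
  then have "(\<lambda>n. sqrt ((\<sigma> (t + real n))\<^sup>2)) \<longlonglongrightarrow> sqrt 0" by (rule tendsto_real_sqrt)
  then have "(\<lambda>n. \<sigma> (t + real n)) \<longlonglongrightarrow> 0" by (simp add: tendsto_rabs_zero_iff)
  with t c show ?thesis by (intro exI[of _ t]) auto
qed

text \<open>If a difference vanishes identically, the previous difference \<open>\<psi>\<close> has period one. The points
  \<open>t\<close> with \<open>\<sigma>(t + n) \<longlonglongrightarrow> 0\<close> are dense, and \<open>\<psi>(t + n) \<longlonglongrightarrow> 0\<close> at them as well, so the
  periodic function \<open>\<psi>\<close> vanishes on a dense set. Decay along \<open>t + n\<close> passes from a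
  function to its difference at once, which makes the induction work.\<close>

lemma unit_difference_power_nonzero:
  assumes \<sigma>: "is_C1 \<sigma>" and L2: "square_integrable_on \<sigma> UNIV" and "\<sigma> \<noteq> (\<lambda>_. 0)"
  shows "(unit_difference ^^ k) \<sigma> \<noteq> (\<lambda>_. 0)"
proof (induction k)
  case 0
  then show ?case using assms by simp
next
  case (Suc k)
  define \<psi> where "\<psi> = (unit_difference ^^ k) \<sigma>"
  have decay: "(\<lambda>n. (unit_difference ^^ j) \<sigma> (t + real n)) \<longlonglongrightarrow> 0"
    if "(\<lambda>n. \<sigma> (t + real n)) \<longlonglongrightarrow> 0" for t j
  proof (induction j)
    case (Suc j)
    have "(\<lambda>n. (unit_difference ^^ j) \<sigma> (t + real (Suc n)) - (unit_difference ^^ j) \<sigma> (t + real n)) \<longlonglongrightarrow> 0 - 0"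
      by (intro tendsto_diff LIMSEQ_Suc[OF Suc.IH] Suc.IH)
    then show ?case by (simp add: unit_difference_def[of "(unit_difference ^^ j) \<sigma>"] add_ac)
  qed (use that in simp)
  show ?case
  proof
    assume "(unit_difference ^^ Suc k) \<sigma> = (\<lambda>_. 0)"
    then have step: "\<psi> (t + 1) = \<psi> t" for t
      by (simp add: \<psi>_def unit_difference_def fun_eq_iff)
    have per: "\<psi> (t + real n) = \<psi> t" for t n
    proof (induction n)
      case (Suc n)
      then show ?case using step[of "t + real n"] by (simp add: add_ac)
    qed simp
    have cont: "continuous_on UNIV \<psi>"
      unfolding \<psi>_def by (intro is_C1_continuous is_C1_unit_difference_power \<sigma>)
    have "\<psi> t = 0" for t
    proof (rule ccontr)
      assume "\<psi> t \<noteq> 0"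
      moreover have "isCont \<psi> t" using cont by (simp add: continuous_on_eq_continuous_at)
      ultimately obtain d where d: "d > 0" "\<And>s. dist t s < d \<Longrightarrow> \<psi> s \<noteq> 0"
        using continuous_at_avoid[of t \<psi> 0] by auto
      obtain s where s: "t < s" "s < t + d" "(\<lambda>n. \<sigma> (s + real n)) \<longlonglongrightarrow> 0"
        using exists_shifts_tendsto_zero[OF is_C1_continuous[OF \<sigma>] L2, of t "t + d"] d by auto
      have "(\<lambda>n. \<psi> (s + real n)) \<longlonglongrightarrow> 0" unfolding \<psi>_def by (rule decay[OF s(3)])
      then have "\<psi> s = 0" by (simp add: per LIMSEQ_const_iff)
      with d(2)[of s] s show False by (simp add: dist_real_def)
    qed
    with Suc show False by (auto simp: \<psi>_def)
  qed
qed

section \<open>Limits of polynomials\<close>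

abbreviation polynomials :: "('a::euclidean_space \<Rightarrow> real) set" where
  "polynomials \<equiv> Collect real_polynomial_function"

text \<open>One-dimensional \<open>C\<^sup>1\<close> approximation by polynomials reduces to the theorem of Weierstrass:
  approximate the derivative and integrate the polynomial.\<close>

lemma ridge_in_polynomial_closure:
  fixes a :: "'a::euclidean_space"
  assumes \<phi>: "\<And>t. (\<phi> has_real_derivative \<phi>' t) (at t)" "continuous_on UNIV \<phi>'"
  shows "C1_limit polynomials (\<lambda>x. \<phi> (a \<bullet> x + b)) (\<lambda>x. \<phi>' (a \<bullet> x + b) *\<^sub>R a)"
  unfolding C1_limit_def
proof (intro conjI allI impI has_C1_gradient_ridge \<phi>)
  fix R e :: real assume "e > 0"
  \<comment> \<open>\<open>M\<close> bounds both the argument \<open>a \<bullet> x + b\<close> on the ball and the factor \<open>a\<close> of the gradient.\<close>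
  define M where "M = \<bar>norm a * R + \<bar>b\<bar>\<bar> + norm a + 1"
  have M: "\<bar>a \<bullet> x + b\<bar> \<le> M" if "norm x \<le> R" for x
    using inner_affine_bound[OF that, of a b] norm_ge_zero[of a] unfolding M_def by linarith
  have M1: "M \<ge> 1" "norm a \<le> M" by (auto simp: M_def)
  define d where "d = e / (2 * M)"
  have d: "d > 0" "d * M < e" using M1 \<open>e > 0\<close> by (auto simp: d_def field_simps)
  obtain p where "real_polynomial_function p" and p: "\<And>t. t \<in> cball 0 M \<Longrightarrow> \<bar>\<phi>' t - p t\<bar> < d"
    using Stone_Weierstrass_real_polynomial_function[OF compact_cball continuous_on_subset[OF \<phi>(2)] d(1)]
    by (metis subset_UNIV)
  then obtain c n where p_eq: "p = (\<lambda>x. \<Sum>i\<le>n. c i * x ^ i)"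
    by (auto simp: real_polynomial_function_iff_sum)
  define P where "P t = \<phi> 0 + (\<Sum>i\<le>n. c i / Suc i * t ^ Suc i)" for t :: real
  have "(P has_real_derivative (\<Sum>i\<le>n. c i / Suc i * (Suc i * t ^ i))) (at t)" for t :: real
    unfolding P_def by (auto intro!: derivative_eq_intros sum.cong simp del: of_nat_Suc power_Suc)
  then have P: "(P has_real_derivative p t) (at t)" for t
    by (simp add: p_eq del: of_nat_Suc)
  have close: "\<bar>P t - \<phi> t\<bar> \<le> d * M" if "\<bar>t\<bar> \<le> M" for t
  proof -
    have "norm ((P t - \<phi> t) - (P 0 - \<phi> 0)) \<le> d * norm (t - 0)"
    proof (rule field_differentiable_bound)
      show "convex (cball (0::real) M)" by simp
      show "((\<lambda>t. P t - \<phi> t) has_field_derivative p z - \<phi>' z) (at z within cball 0 M)" for z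
        by (rule has_field_derivative_at_within[OF DERIV_diff[OF P \<phi>(1)]])
      show "norm (p z - \<phi>' z) \<le> d" if "z \<in> cball 0 M" for z
        using p[OF that] by simp
    qed (use that M1 in auto)
    also have "\<dots> \<le> d * M" using that d(1) by (intro mult_left_mono) auto
    finally show ?thesis by (simp add: P_def)
  qed
  have "real_polynomial_function (P \<circ> (\<lambda>x. a \<bullet> x + b))"
  proof (rule real_polynomial_function_compose)
    show "polynomial_function (\<lambda>x. a \<bullet> x + b)"
      by (simp add: real_polynomial_function_eq[symmetric])
        (intro real_polynomial_function.intros bounded_linear_inner_right)
    show "real_polynomial_function P"
      unfolding P_def by (intro real_polynomial_function.intros real_polynomial_function_sum
        real_polynomial_function_power bounded_linear_ident) auto
  qed
  then have "(\<lambda>x. P (a \<bullet> x + b)) \<in> polynomials" by (simp add: o_def)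
  moreover have "has_C1_gradient (\<lambda>x. P (a \<bullet> x + b)) (\<lambda>x. p (a \<bullet> x + b) *\<^sub>R a)"
    by (rule has_C1_gradient_ridge[OF P]) (auto simp: p_eq intro!: continuous_intros)
  moreover have "\<bar>P (a \<bullet> x + b) - \<phi> (a \<bullet> x + b)\<bar> < e \<and>
      norm (p (a \<bullet> x + b) *\<^sub>R a - \<phi>' (a \<bullet> x + b) *\<^sub>R a) < e" if "norm x \<le> R" for x
  proof
    show "\<bar>P (a \<bullet> x + b) - \<phi> (a \<bullet> x + b)\<bar> < e"
      using close[OF M[OF that]] d(2) by linarith
    have "norm (p (a \<bullet> x + b) *\<^sub>R a - \<phi>' (a \<bullet> x + b) *\<^sub>R a) = \<bar>\<phi>' (a \<bullet> x + b) - p (a \<bullet> x + b)\<bar> * norm a"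
      by (simp add: scaleR_left_diff_distrib[symmetric] abs_minus_commute)
    also have "\<dots> \<le> d * M"
      using p[of "a \<bullet> x + b"] M[OF that] M1 d(1) by (intro mult_mono) auto
    finally show "norm (p (a \<bullet> x + b) *\<^sub>R a - \<phi>' (a \<bullet> x + b) *\<^sub>R a) < e"
      using d(2) by linarith
  qed
  ultimately show "\<exists>g\<in>polynomials. \<exists>g'. has_C1_gradient g g' \<and>
      (\<forall>x\<in>cball 0 R. \<bar>g x - \<phi> (a \<bullet> x + b)\<bar> < e \<and> norm (g' x - \<phi>' (a \<bullet> x + b) *\<^sub>R a) < e)"
    by (intro bexI[of _ "\<lambda>x. P (a \<bullet> x + b)"] exI[of _ "\<lambda>x. p (a \<bullet> x + b) *\<^sub>R a"]) auto
qed

lemma polynomials_closed: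
  "f \<in> polynomials \<Longrightarrow> g \<in> polynomials \<Longrightarrow> (\<lambda>x. f x + g x) \<in> polynomials"
  "f \<in> polynomials \<Longrightarrow> g \<in> polynomials \<Longrightarrow> (\<lambda>x. f x * g x) \<in> polynomials"
  "(\<lambda>_. 0) \<in> polynomials"
  by auto

lemma affine_C1_limit:
  fixes v :: "'a::euclidean_space"
  shows "C1_limit polynomials (\<lambda>x. c + v \<bullet> (x - y)) (\<lambda>_. v)"
proof -
  have "C1_limit polynomials (\<lambda>x. v \<bullet> x + (c - v \<bullet> y)) (\<lambda>_. 1 *\<^sub>R v)"
    by (rule ridge_in_polynomial_closure[where \<phi> = "\<lambda>t. t" and \<phi>' = "\<lambda>_. 1"]) (auto intro!: derivative_eq_intros)
  then show ?thesis by (simp add: inner_diff_right algebra_simps)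
qed

lemma prod_in_polynomial_closure:
  fixes f :: "'i \<Rightarrow> 'a::euclidean_space \<Rightarrow> real"
  assumes "finite I" "\<And>i. i \<in> I \<Longrightarrow> f i \<in> C1_closure polynomials"
  shows "(\<lambda>x. \<Prod>i\<in>I. f i x) \<in> C1_closure polynomials"
  using assms
proof (induction I)
  case empty
  have "C1_limit polynomials (\<lambda>_. 1) (\<lambda>_. 0)" by (intro C1_limit_self has_C1_gradient_const) auto
  then show ?case by (auto simp: C1_closure_def)
next
  case (insert i I)
  obtain f' where f': "C1_limit polynomials (f i) f'"
    using insert.prems[of i] by (auto simp: C1_closure_def)
  obtain g' where g': "C1_limit polynomials (\<lambda>x. \<Prod>i\<in>I. f i x) g'"
    using insert.IH insert.prems by (auto simp: C1_closure_def)
  from C1_limit_mult[OF polynomials_closed(2) f' g'] insert.hyps show ?case by (auto simp: C1_closure_def)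
qed

section \<open>From first-order jets to polynomials\<close>

lemma sum_int_telescope:
  fixes f :: "int \<Rightarrow> real"
  assumes "k \<le> m" shows "(\<Sum>j\<in>{k..m}. f j - f (j + 1)) = f k - f (m + 1)"
  using assms
proof (induction m rule: int_ge_induct)
  case (step i)
  have "{k..i + 1} = insert (i + 1) {k..i}" using step.hyps by auto
  then show ?case using step.IH by simp
qed simp

text \<open>The square of the positive part of \<open>t\<close>, in a form whose derivative is easy to compute.\<close>

definition square_plus :: "real \<Rightarrow> real" where "square_plus t = (t\<^sup>2 + t * \<bar>t\<bar>) / 2"

lemma DERIV_square_plus: "(square_plus has_real_derivative t + \<bar>t\<bar>) (at t)"
proof -
  have "((\<lambda>t. t * \<bar>t\<bar>) has_real_derivative 2 * \<bar>t\<bar>) (at t)"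
  proof (cases "t = 0")
    case True
    then show ?thesis
      unfolding DERIV_caratheodory_within
      by (auto intro!: exI[of _ abs] continuous_intros)
  next
    case False
    then have "((\<lambda>z. sgn t * z\<^sup>2) has_real_derivative 2 * \<bar>t\<bar>) (at t)"
      by (auto intro!: derivative_eq_intros simp: abs_sgn)
    then show ?thesis
      by (rule has_field_derivative_transform_within_open[where S = "{z. 0 < sgn t * z}"])
        (use False in \<open>auto simp: open_Collect_less continuous_intros sgn_if power2_eq_square split: if_splits\<close>)
  qed
  then have "((\<lambda>t. (t\<^sup>2 + t * \<bar>t\<bar>) / 2) has_real_derivative (2 * t + 2 * \<bar>t\<bar>) / 2) (at t)"
    by (intro DERIV_cdivide DERIV_add) (auto intro!: derivative_eq_intros)
  then show ?thesis by (simp add: square_plus_def[abs_def] add_divide_distrib)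
qed

text \<open>Let \<open>S\<close> be a \<open>C\<^sup>1\<close> function that is \<open>0\<close> on \<open>t \<le> 0\<close> and \<open>1\<close> on \<open>t \<ge> 2\<close>. The translates of
  \<open>B(t) = S(t) - S(t - 1)\<close> by integers add up to one by telescoping. At most four
  of them are nonzero at a given point, which gives bounds that do not depend on the number of
  translates.\<close>

lemma unit_bump_exists:
  obtains B B' :: "real \<Rightarrow> real" and c :: real where
    "\<And>t. (B has_real_derivative B' t) (at t)" "continuous_on UNIV B'" "c \<ge> 0"
    "\<And>t. \<not> (0 < t \<and> t < 3) \<Longrightarrow> B t = 0 \<and> B' t = 0"
    "\<And>t m. \<bar>t\<bar> \<le> real_of_int m - 3 \<Longrightarrow> (\<Sum>j\<in>{-m..m}. B (t - of_int j)) = 1 \<and> (\<Sum>j\<in>{-m..m}. B' (t - of_int j)) = 0"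
    "\<And>t J. finite J \<Longrightarrow> (\<Sum>j\<in>J. \<bar>B (t - of_int j)\<bar>) \<le> c \<and> (\<Sum>j\<in>J. \<bar>B' (t - of_int j)\<bar>) \<le> c"
proof -
  \<comment> \<open>Second differences of the squared positive part are constant beyond the last knot: \<open>S\<close> is a
    quadratic spline with knots \<open>0, 1, 2\<close>.\<close>
  define S where "S t = (square_plus t - 2 * square_plus (t - 1) + square_plus (t - 2)) / 2" for t
  define S' where "S' t = ((t + \<bar>t\<bar>) - 2 * ((t - 1) + \<bar>t - 1\<bar>) + ((t - 2) + \<bar>t - 2\<bar>)) / 2" for t :: real
  have S: "(S has_real_derivative S' t) (at t)" for t
    unfolding S_def[abs_def] S'_def
    by (auto intro!: derivative_eq_intros DERIV_chain2[where f = square_plus, OF DERIV_square_plus])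
  have S_low: "S t = 0 \<and> S' t = 0" if "t \<le> 0" for t
    using that by (simp add: S_def S'_def square_plus_def power2_eq_square algebra_simps)
  have S_high: "S t = 1 \<and> S' t = 0" if "t \<ge> 2" for t
    using that by (simp add: S_def S'_def square_plus_def power2_eq_square field_simps)
  define B where "B t = S t - S (t - 1)" for t
  define B' where "B' t = S' t - S' (t - 1)" for t
  have B: "(B has_real_derivative B' t) (at t)" for t
    unfolding B_def[abs_def] B'_def
    by (auto intro!: derivative_eq_intros DERIV_chain2[where f = S] S)
  have B'c: "continuous_on UNIV B'"
    unfolding B'_def S'_def by (intro continuous_intros) auto
  have Bc: "continuous_on UNIV B"
    using B by (meson DERIV_isCont continuous_at_imp_continuous_on)
  have B_out: "B t = 0 \<and> B' t = 0" if "\<not> (0 < t \<and> t < 3)" for t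
    using that S_low[of t] S_low[of "t - 1"] S_high[of t] S_high[of "t - 1"]
    by (cases "t \<le> 0") (auto simp: B_def B'_def)
  have "bounded (B ` {0..3})" "bounded (B' ` {0..3})"
    by (intro compact_imp_bounded compact_continuous_image continuous_on_subset[OF Bc]
        continuous_on_subset[OF B'c]; simp)+
  then obtain c1 c2 where c12: "\<And>t. t \<in> {0..3} \<Longrightarrow> \<bar>B t\<bar> \<le> c1" "\<And>t. t \<in> {0..3} \<Longrightarrow> \<bar>B' t\<bar> \<le> c2"
    unfolding bounded_iff by (metis imageI real_norm_def)
  define c where "c = \<bar>c1\<bar> + \<bar>c2\<bar>"
  have c: "c \<ge> 0" "\<bar>B t\<bar> \<le> c" "\<bar>B' t\<bar> \<le> c" for t
    using c12[of t] B_out[of t] by (cases "t \<in> {0..3}"; force simp: c_def)+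
  have few: "(\<Sum>j\<in>J. \<bar>h (t - of_int j)\<bar>) \<le> 4 * c"
    if "finite J" "\<And>t. \<bar>h t\<bar> \<le> c" "\<And>t. \<not> (0 < t \<and> t < 3) \<Longrightarrow> h t = 0" for h :: "real \<Rightarrow> real" and J t
  proof -
    let ?A = "{\<lfloor>t\<rfloor> - 3..\<lfloor>t\<rfloor>}"
    have "(\<Sum>j\<in>J. \<bar>h (t - of_int j)\<bar>) = (\<Sum>j\<in>J \<inter> ?A. \<bar>h (t - of_int j)\<bar>)"
    proof (rule sum.mono_neutral_right[OF that(1)])
      have "h (t - of_int j) = 0" if "j \<notin> ?A" for j
      proof (rule \<open>\<And>t. \<not> (0 < t \<and> t < 3) \<Longrightarrow> h t = 0\<close>)
        have "j < \<lfloor>t\<rfloor> - 3 \<or> j > \<lfloor>t\<rfloor>" using that by auto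
        then show "\<not> (0 < t - of_int j \<and> t - of_int j < 3)" by linarith
      qed
      then show "\<forall>j\<in>J - J \<inter> ?A. \<bar>h (t - of_int j)\<bar> = 0" by auto
    qed auto
    also have "\<dots> \<le> (\<Sum>j\<in>J \<inter> ?A. c)" by (intro sum_mono that)
    also have "\<dots> = card (J \<inter> ?A) * c" by simp
    also have "\<dots> \<le> 4 * c"
    proof (rule mult_right_mono)
      have "card (J \<inter> ?A) \<le> card ?A" by (intro card_mono) auto
      then show "real (card (J \<inter> ?A)) \<le> 4" by simp
    qed (rule c)
    finally show ?thesis .
  qed
  show ?thesis
  proof (rule that[of B B' "4 * c"])
    show "4 * c \<ge> 0" using c by simp
    fix t :: real and m :: int assume t: "\<bar>t\<bar> \<le> real_of_int m - 3"
    then have m: "-m \<le> m" by linarith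
    show "(\<Sum>j\<in>{-m..m}. B (t - of_int j)) = 1 \<and> (\<Sum>j\<in>{-m..m}. B' (t - of_int j)) = 0"
      using sum_int_telescope[OF m, of "\<lambda>j. S (t - of_int j)"] sum_int_telescope[OF m, of "\<lambda>j. S' (t - of_int j)"]
        S_high[of "t + m"] S_low[of "t - (m + 1)"] t
      by (simp add: B_def B'_def diff_diff_eq)
  next
    fix t :: real and J :: "int set" assume J: "finite J"
    show "(\<Sum>j\<in>J. \<bar>B (t - of_int j)\<bar>) \<le> 4 * c \<and> (\<Sum>j\<in>J. \<bar>B' (t - of_int j)\<bar>) \<le> 4 * c"
      using few[OF J, of B t] few[OF J, of B' t] c B_out by blast
  qed (use B B'c B_out in auto)
qed

lemma norm_le_of_coordinates:
  fixes x :: "'a::euclidean_space" and e :: real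
  assumes "\<And>b. b \<in> Basis \<Longrightarrow> \<bar>x \<bullet> b\<bar> \<le> e"
  shows "norm x \<le> DIM('a) * e"
  using norm_le_l1[of x] sum_bounded_above[of Basis "\<lambda>b. \<bar>x \<bullet> b\<bar>" e] assms by simp

text \<open>Cells of mesh \<open>s\<close> are indexed by functions from the basis to the integers, so that a sum over
  all cells of a product over the coordinates factors into one-dimensional sums.\<close>

definition grid_bump :: "(real \<Rightarrow> real) \<Rightarrow> real \<Rightarrow> ('a \<Rightarrow> int) \<Rightarrow> 'a::euclidean_space \<Rightarrow> real" where
  "grid_bump B s i x = (\<Prod>b\<in>Basis. B ((x \<bullet> b) / s - of_int (i b)))"

text \<open>The \<open>b\<close>-th partial derivative is again written as a product over all coordinates, with the derivative
  in place of the bump at \<open>b\<close>, so that its sums over the grid factor in the same way.\<close>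

definition grid_bump_gradient ::
  "(real \<Rightarrow> real) \<Rightarrow> (real \<Rightarrow> real) \<Rightarrow> real \<Rightarrow> ('a \<Rightarrow> int) \<Rightarrow> 'a::euclidean_space \<Rightarrow> 'a" where
  "grid_bump_gradient B B' s i x =
     (\<Sum>b\<in>Basis. ((\<Prod>l\<in>Basis. (if l = b then B' else B) ((x \<bullet> l) / s - of_int (i l))) / s) *\<^sub>R b)"

lemma grid_bump_C1_limit:
  fixes i :: "'a::euclidean_space \<Rightarrow> int"
  assumes B: "\<And>t. (B has_real_derivative B' t) (at t)" "continuous_on UNIV B'" and "s > 0"
  shows "C1_limit polynomials (grid_bump B s i) (grid_bump_gradient B B' s i)"
proof (rule C1_closure_limit)
  have "(\<lambda>x. B ((x \<bullet> b) / s - of_int (i b))) \<in> C1_closure polynomials" for b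
  proof -
    have "(\<lambda>x. B (((1 / s) *\<^sub>R b) \<bullet> x + - of_int (i b))) \<in> C1_closure polynomials"
      using ridge_in_polynomial_closure[OF B] unfolding C1_closure_def by blast
    then show ?thesis by (simp add: inner_commute)
  qed
  then show "grid_bump B s i \<in> C1_closure polynomials"
    unfolding grid_bump_def[abs_def] by (intro prod_in_polynomial_closure) auto
next
  have Bc: "continuous_on UNIV B"
    using B(1) by (meson DERIV_isCont continuous_at_imp_continuous_on)
  have "GDERIV (grid_bump B s i) x :> grid_bump_gradient B B' s i x" for x
  proof -
    have 1: "((\<lambda>x. B ((x \<bullet> b) / s - of_int (i b))) has_derivative
        (\<lambda>h. (h \<bullet> b) / s * B' ((x \<bullet> b) / s - of_int (i b)))) (at x)" for b
      by (rule has_derivative_eq_rhs[OF DERIV_compose_FDERIV[OF B(1)]])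
        (auto intro!: derivative_eq_intros simp: \<open>s > 0\<close>[THEN less_imp_neq, symmetric])
    have "((\<lambda>x. \<Prod>b\<in>Basis. B ((x \<bullet> b) / s - of_int (i b))) has_derivative
        (\<lambda>h. \<Sum>b\<in>Basis. (h \<bullet> b) / s * B' ((x \<bullet> b) / s - of_int (i b)) *
          (\<Prod>l\<in>Basis - {b}. B ((x \<bullet> l) / s - of_int (i l))))) (at x)"
      by (rule has_derivative_prod[OF 1])
    moreover have eq: "(h \<bullet> b) / s * B' ((x \<bullet> b) / s - of_int (i b)) *
          (\<Prod>l\<in>Basis - {b}. B ((x \<bullet> l) / s - of_int (i l)))
        = h \<bullet> (((\<Prod>l\<in>Basis. (if l = b then B' else B) ((x \<bullet> l) / s - of_int (i l))) / s) *\<^sub>R b)"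
      if "b \<in> Basis" for b h
      using that by (subst (2) prod.remove[of _ b]) (auto intro!: arg_cong2[where f = "(*)"] prod.cong)
    ultimately show ?thesis
      unfolding gderiv_def grid_bump_def[abs_def] grid_bump_gradient_def inner_sum_right
      by (simp only: eq cong: sum.cong)
  qed
  moreover have "continuous_on UNIV (\<lambda>x::'a. (if l = b then B' else B) ((x \<bullet> l) / s - of_int (i l)))" for l b
    using \<open>s > 0\<close>
    by (cases "l = b")
      (auto intro!: continuous_on_compose2[OF B(2)] continuous_on_compose2[OF Bc] continuous_intros)
  then have "continuous_on UNIV (grid_bump_gradient B B' s i)"
    unfolding grid_bump_gradient_def[abs_def] using \<open>s > 0\<close> by (intro continuous_intros) auto
  ultimately show "has_C1_gradient (grid_bump B s i) (grid_bump_gradient B B' s i)"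
    by (simp add: has_C1_gradient_def)
qed

lemma sum_grid:
  fixes g :: "'a::euclidean_space \<Rightarrow> int \<Rightarrow> real"
  assumes "finite J"
  shows "(\<Sum>i\<in>PiE Basis (\<lambda>_. J). \<Prod>b\<in>Basis. g b (i b)) = (\<Prod>b\<in>Basis. \<Sum>j\<in>J. g b j)"
  using prod_sum_PiE[of Basis "\<lambda>_. J" g] assms by simp

text \<open>The pair \<open>(f, F)\<close> behaves on \<open>K\<close> like a function with its gradient, at distances up to \<open>r\<close> and up
  to the relative error \<open>\<eta>\<close>. In contrast to Whitney's condition, \<open>\<eta>\<close> is a fixed number and not
  \<open>o(1)\<close>.\<close>

definition jet_on :: "'a::euclidean_space set \<Rightarrow> ('a \<Rightarrow> real) \<Rightarrow> ('a \<Rightarrow> 'a) \<Rightarrow> real \<Rightarrow> real \<Rightarrow> bool" where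
  "jet_on K f F r \<eta> \<longleftrightarrow> (\<forall>x\<in>K. \<forall>y\<in>K. norm (x - y) \<le> r \<longrightarrow>
     norm (F x - F y) \<le> \<eta> \<and> \<bar>f x - f y - F y \<bullet> (x - y)\<bar> \<le> \<eta> * norm (x - y))"

text \<open>With a partition of unity \<open>w\<^sub>i\<close> of mesh \<open>s\<close> comparable to \<open>r\<close> and points \<open>y\<^sub>i\<close> of \<open>K\<close> in the
  supports, let \<open>G = \<Sum> w\<^sub>i T\<^sub>i\<close> with \<open>T\<^sub>i(x) = f(y\<^sub>i) + F(y\<^sub>i) \<bullet> (x - y\<^sub>i)\<close>. On \<open>K\<close>, where the
  weights sum to one and their gradients to zero,
  \<open>\<nabla>G - F = \<Sum> w\<^sub>i (F(y\<^sub>i) - F) + \<Sum> (T\<^sub>i - f) \<nabla>w\<^sub>i\<close>. The second sum is of order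
  \<open>\<eta> r / s\<close>, since \<open>T\<^sub>i - f\<close> is at most \<open>\<eta> r\<close> on the support of \<open>w\<^sub>i\<close>; hence the constant \<open>C\<close>
  depends on the dimension only.\<close>

proposition C1_limit_of_jet:
  "\<exists>C>0. \<forall>(K::'a::euclidean_space set) f F r \<eta>. bounded K \<longrightarrow> r > 0 \<longrightarrow> \<eta> \<ge> 0 \<longrightarrow> jet_on K f F r \<eta> \<longrightarrow>
    (\<exists>G G'. C1_limit polynomials G G' \<and> (\<forall>x\<in>K. norm (G' x - F x) \<le> C * \<eta>))"
proof -
  obtain B B' :: "real \<Rightarrow> real" and c :: real where
    B: "\<And>t. (B has_real_derivative B' t) (at t)" "continuous_on UNIV B'" "c \<ge> 0"
    and B_out: "\<And>t. \<not> (0 < t \<and> t < 3) \<Longrightarrow> B t = 0 \<and> B' t = 0"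
    and B_sum: "\<And>t m. \<bar>t\<bar> \<le> real_of_int m - 3 \<Longrightarrow>
        (\<Sum>j\<in>{-m..m}. B (t - of_int j)) = 1 \<and> (\<Sum>j\<in>{-m..m}. B' (t - of_int j)) = 0"
    and B_abs: "\<And>t J. finite J \<Longrightarrow>
        (\<Sum>j\<in>J. \<bar>B (t - of_int j)\<bar>) \<le> c \<and> (\<Sum>j\<in>J. \<bar>B' (t - of_int j)\<bar>) \<le> c"
    using unit_bump_exists by blast
  define d where "d = real DIM('a)"
  have d: "d \<ge> 1" unfolding d_def using DIM_positive[where 'a='a] by linarith
  \<comment> \<open>The summand \<open>1\<close> only ensures that \<open>C\<close> is positive.\<close>
  define C where "C = c ^ DIM('a) * (1 + 3 * d\<^sup>2) + 1"
  show ?thesis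
  proof (intro exI[of _ C] conjI allI impI)
    show "C > 0" unfolding C_def using B(3) by (intro add_nonneg_pos mult_nonneg_nonneg) auto
  next
    fix K :: "'a set" and f F \<eta> and r :: real
    assume K: "bounded K" and r: "r > 0" and \<eta>: "\<eta> \<ge> 0"
      and jet_on: "jet_on K f F r \<eta>"
    have jet: "norm (F x - F y) \<le> \<eta> \<and> \<bar>f x - f y - F y \<bullet> (x - y)\<bar> \<le> \<eta> * norm (x - y)"
      if "x \<in> K" "y \<in> K" "norm (x - y) \<le> r" for x y
      using jet_on that by (simp add: jet_on_def)
    \<comment> \<open>A support is a cube of side \<open>3 s\<close>, of diameter at most \<open>3 s d = r\<close>.\<close>
    define s where "s = r / (3 * d)"
    have s: "s > 0" using r d by (simp add: s_def)
    obtain R where R: "\<And>x. x \<in> K \<Longrightarrow> norm x \<le> R" using K by (auto simp: bounded_iff)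
    \<comment> \<open>Indices up to \<open>m\<close> suffice for the translates to sum to one on \<open>K\<close>.\<close>
    define m where "m = \<lceil>R / s\<rceil> + 3"
    have m: "\<bar>(x \<bullet> b) / s\<bar> \<le> real_of_int m - 3" if "x \<in> K" "b \<in> Basis" for x b
    proof -
      have "\<bar>x \<bullet> b\<bar> \<le> R" using Basis_le_norm[OF that(2), of x] R[OF that(1)] by linarith
      then have "\<bar>(x \<bullet> b) / s\<bar> \<le> R / s" using s by (simp add: divide_right_mono)
      then show ?thesis unfolding m_def by linarith
    qed
    define P where "P = PiE Basis (\<lambda>_::'a. {-m..m})"
    have P: "finite P" unfolding P_def by (intro finite_PiE) auto
    define w :: "('a \<Rightarrow> int) \<Rightarrow> 'a \<Rightarrow> real" where "w = grid_bump B s"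
    define w' :: "('a \<Rightarrow> int) \<Rightarrow> 'a \<Rightarrow> 'a" where "w' = grid_bump_gradient B B' s"
    define active where "active i x \<longleftrightarrow> (\<forall>b\<in>Basis. 0 < (x \<bullet> b) / s - of_int (i b) \<and> (x \<bullet> b) / s - of_int (i b) < 3)"
      for i and x :: 'a
    have inactive: "w i x = 0 \<and> w' i x = 0" if na: "\<not> active i x" for i x
    proof -
      obtain b where "b \<in> Basis" "\<not> (0 < (x \<bullet> b) / s - of_int (i b) \<and> (x \<bullet> b) / s - of_int (i b) < 3)"
        using na unfolding active_def by blast
      with B_out have b: "b \<in> Basis" "B ((x \<bullet> b) / s - of_int (i b)) = 0" "B' ((x \<bullet> b) / s - of_int (i b)) = 0"
        by simp_all
      have "(\<Prod>l\<in>Basis. (if l = k then B' else B) ((x \<bullet> l) / s - of_int (i l))) = 0" for k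
        by (rule prod_zero) (use b in auto)
      then have "w' i x = 0" unfolding w'_def grid_bump_gradient_def by (simp only: div_0 scaleR_zero_left sum.neutral_const)
      moreover have "w i x = 0" unfolding w_def grid_bump_def by (rule prod_zero) (use b in auto)
      ultimately show ?thesis by simp
    qed
    have sum_w: "(\<Sum>i\<in>P. w i x) = 1" if "x \<in> K" for x
      unfolding w_def grid_bump_def P_def
      by (subst sum_grid) (use B_sum m[OF that] in auto)
    have sum_w': "(\<Sum>i\<in>P. w' i x) = 0" if "x \<in> K" for x
    proof -
      have "(\<Sum>i\<in>P. \<Prod>l\<in>Basis. (if l = b then B' else B) ((x \<bullet> l) / s - of_int (i l))) = 0" if "b \<in> Basis" for b
        unfolding P_def
        by (subst sum_grid, simp, rule prod_zero) (use that B_sum m[OF \<open>x \<in> K\<close> that] in \<open>auto intro!: bexI[of _ b]\<close>)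
      then show ?thesis
        unfolding w'_def grid_bump_gradient_def
        by (subst sum.swap) (simp add: scaleR_sum_left[symmetric] sum_divide_distrib[symmetric])
    qed
    have abs_bound: "(\<Sum>i\<in>P. \<bar>(\<Prod>l\<in>Basis. (if l \<in> A then B' else B) ((x \<bullet> l) / s - of_int (i l)))\<bar>) \<le> c ^ DIM('a)" for x A
    proof -
      have "(\<Sum>i\<in>P. \<bar>(\<Prod>l\<in>Basis. (if l \<in> A then B' else B) ((x \<bullet> l) / s - of_int (i l)))\<bar>)
        = (\<Prod>l\<in>Basis. \<Sum>j\<in>{-m..m}. \<bar>(if l \<in> A then B' else B) ((x \<bullet> l) / s - of_int j)\<bar>)"
        unfolding P_def abs_prod by (subst sum_grid) auto
      also have "\<dots> \<le> (\<Prod>l\<in>(Basis::'a set). c)"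
        by (rule prod_mono) (use B_abs[of "{-m..m}"] in \<open>auto intro!: sum_nonneg\<close>)
      finally show ?thesis by simp
    qed
    have abs_w: "(\<Sum>i\<in>P. \<bar>w i x\<bar>) \<le> c ^ DIM('a)" for x
      using abs_bound[where A = "{}" and x = x] by (simp add: w_def grid_bump_def)
    have abs_w': "(\<Sum>i\<in>P. norm (w' i x)) \<le> d * (c ^ DIM('a) / s)" for x
    proof -
      have "(\<Sum>i\<in>P. norm (w' i x)) \<le>
        (\<Sum>i\<in>P. \<Sum>b\<in>Basis. \<bar>(\<Prod>l\<in>Basis. (if l \<in> {b} then B' else B) ((x \<bullet> l) / s - of_int (i l)))\<bar> / s)"
        unfolding w'_def grid_bump_gradient_def
        by (rule sum_mono, rule sum_norm_le) (use s in auto)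
      also have "\<dots> \<le> (\<Sum>b\<in>(Basis::'a set). c ^ DIM('a) / s)"
        unfolding sum.swap[of _ _ P] sum_divide_distrib[symmetric]
        by (intro sum_mono divide_right_mono abs_bound) (use s in auto)
      finally show ?thesis by (simp add: d_def)
    qed
    \<comment> \<open>Only cells that meet \<open>K\<close> are used, since a Taylor polynomial is available only at points of \<open>K\<close>.\<close>
    define I where "I = {i \<in> P. \<exists>y\<in>K. active i y}"
    define y where "y i = (SOME y. y \<in> K \<and> active i y)" for i
    have y: "y i \<in> K \<and> active i (y i)" if "i \<in> I" for i
      using someI_ex[of "\<lambda>y. y \<in> K \<and> active i y"] that by (auto simp: I_def y_def Bex_def)
    have I: "finite I" "I \<subseteq> P" using P by (auto simp: I_def)
    have restrict: "(\<Sum>i\<in>I. h i) = (\<Sum>i\<in>P. h i)" if "x \<in> K" "\<And>i. \<not> active i x \<Longrightarrow> h i = 0"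
      for x and h :: "_ \<Rightarrow> 'b::comm_monoid_add"
      by (rule sum.mono_neutral_left[OF P I(2)]) (use that in \<open>auto simp: I_def\<close>)
    have close: "norm (x - y i) \<le> r" if "i \<in> I" "active i x" for i x
    proof -
      have coord: "\<bar>(x - y i) \<bullet> b\<bar> \<le> 3 * s" if b: "b \<in> Basis" for b
      proof -
        have "\<bar>(x \<bullet> b) / s - (y i \<bullet> b) / s\<bar> \<le> 3"
          using y[OF \<open>i \<in> I\<close>] \<open>active i x\<close> b unfolding active_def by (smt (verit))
        then have "\<bar>((x - y i) \<bullet> b) / s\<bar> \<le> 3" by (simp add: inner_diff_left diff_divide_distrib)
        then show ?thesis using s by (simp add: field_simps)
      qed
      have "norm (x - y i) \<le> d * (3 * s)" unfolding d_def by (rule norm_le_of_coordinates[OF coord])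
      also have "\<dots> = r" using d by (simp add: s_def)
      finally show ?thesis .
    qed
    define T where "T i x = f (y i) + F (y i) \<bullet> (x - y i)" for i x
    define G where "G x = (\<Sum>i\<in>I. w i x * T i x)" for x
    define G' where "G' x = (\<Sum>i\<in>I. w i x *\<^sub>R F (y i) + T i x *\<^sub>R w' i x)" for x
    have "C1_limit polynomials G G'"
      unfolding G_def[abs_def] G'_def[abs_def]
      by (intro C1_limit_sum C1_limit_mult polynomials_closed I)
        (auto simp: w_def w'_def T_def intro!: grid_bump_C1_limit B s affine_C1_limit)
    moreover have "norm (G' x - F x) \<le> C * \<eta>" if x: "x \<in> K" for x
    proof -
      have 1: "(\<Sum>i\<in>I. w i x) = 1" "(\<Sum>i\<in>I. w' i x) = 0"
        by (subst restrict[OF x]; simp add: inactive sum_w sum_w' x)+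
      have "G' x - F x = G' x - (\<Sum>i\<in>I. w i x) *\<^sub>R F x - f x *\<^sub>R (\<Sum>i\<in>I. w' i x)" by (simp add: 1)
      also have "\<dots> = (\<Sum>i\<in>I. w i x *\<^sub>R (F (y i) - F x) + (T i x - f x) *\<^sub>R w' i x)"
        unfolding G'_def scaleR_sum_left scaleR_sum_right sum_subtractf[symmetric]
        by (intro sum.cong) (auto simp: algebra_simps)
      also have "norm \<dots> \<le> (\<Sum>i\<in>I. \<bar>w i x\<bar> * \<eta> + (\<eta> * r) * norm (w' i x))"
      proof (rule sum_norm_le)
        fix i assume i: "i \<in> I"
        show "norm (w i x *\<^sub>R (F (y i) - F x) + (T i x - f x) *\<^sub>R w' i x)
          \<le> \<bar>w i x\<bar> * \<eta> + (\<eta> * r) * norm (w' i x)"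
        proof (cases "active i x")
          case True
          have yK: "y i \<in> K" using y[OF i] by simp
          have "norm (F (y i) - F x) \<le> \<eta>"
            using jet[OF x yK close[OF i True]] by (simp add: norm_minus_commute)
          moreover have "\<bar>T i x - f x\<bar> \<le> \<eta> * r"
          proof -
            have "\<bar>T i x - f x\<bar> = \<bar>f x - f (y i) - F (y i) \<bullet> (x - y i)\<bar>" by (simp add: T_def)
            also have "\<dots> \<le> \<eta> * norm (x - y i)" using jet[OF x yK close[OF i True]] by simp
            also have "\<dots> \<le> \<eta> * r" using close[OF i True] \<eta> by (rule mult_left_mono)
            finally show ?thesis .
          qed
          ultimately show ?thesis
            by (intro norm_triangle_le) (auto intro!: add_mono mult_left_mono mult_right_mono)
        qed (use inactive \<eta> r in auto)
      qed
      also have "\<dots> \<le> (\<Sum>i\<in>P. \<bar>w i x\<bar> * \<eta> + (\<eta> * r) * norm (w' i x))"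
        by (rule sum_mono2[OF P I(2)]) (use \<eta> r in auto)
      also have "\<dots> = (\<Sum>i\<in>P. \<bar>w i x\<bar>) * \<eta> + (\<eta> * r) * (\<Sum>i\<in>P. norm (w' i x))"
        by (simp add: sum.distrib sum_distrib_left sum_distrib_right)
      also have "\<dots> \<le> c ^ DIM('a) * \<eta> + (\<eta> * r) * (d * (c ^ DIM('a) / s))"
        using \<eta> r by (intro add_mono mult_right_mono mult_left_mono abs_w abs_w') auto
      also have "\<dots> = c ^ DIM('a) * (1 + 3 * d\<^sup>2) * \<eta>"
        using r d by (simp add: s_def field_simps power2_eq_square)
      also have "\<dots> \<le> C * \<eta>" unfolding C_def using \<eta> by (intro mult_right_mono) auto
      finally show ?thesis .
    qed
    ultimately show "\<exists>G G'. C1_limit polynomials G G' \<and> (\<forall>x\<in>K. norm (G' x - F x) \<le> C * \<eta>)" by blast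
  qed
qed

section \<open>A potential for a continuous gradient field on a compact set\<close>

text \<open>Total length \<open>l\<close> and total cost \<open>h\<close> are arguments of the predicate instead of functions of a
  list of points, so that statements on lengths and costs are plain rule inductions.\<close>

inductive chain :: "'a::euclidean_space set \<Rightarrow> real \<Rightarrow> ('a \<Rightarrow> 'a \<Rightarrow> real) \<Rightarrow> 'a \<Rightarrow> 'a \<Rightarrow> real \<Rightarrow> real \<Rightarrow> bool"
  for K \<delta> e where
  start: "x \<in> K \<Longrightarrow> chain K \<delta> e x x 0 0"
| step: "\<lbrakk>chain K \<delta> e x y l h; z \<in> K; norm (z - y) \<le> \<delta>\<rbrakk> \<Longrightarrow>
    chain K \<delta> e x z (l + norm (z - y)) (h + e y z)"

lemma chain_endpoints:
  "chain K \<delta> e x y l h \<Longrightarrow> x \<in> K \<and> y \<in> K \<and> norm (y - x) \<le> l"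
proof (induction rule: chain.induct)
  case (step x y l h z)
  then show ?case using norm_triangle_ineq[of "z - y" "y - x"] by auto
qed auto

lemma chain_mono: "chain K \<delta> e x y l h \<Longrightarrow> \<delta> \<le> \<delta>' \<Longrightarrow> chain K \<delta>' e x y l h"
  by (induction rule: chain.induct) (auto intro: chain.intros)

text \<open>The first point that is reached at length at least \<open>t\<close> overshoots \<open>t\<close> by at most the last step.\<close>

lemma chain_split:
  assumes "chain K \<delta> e x y l h" "0 \<le> t" "t \<le> l" "0 \<le> \<delta>"
  shows "\<exists>z l1 h1 l2 h2. chain K \<delta> e x z l1 h1 \<and> chain K \<delta> e z y l2 h2 \<and>
    l = l1 + l2 \<and> h = h1 + h2 \<and> \<bar>l1 - t\<bar> \<le> \<delta>"
  using assms
proof (induction rule: chain.induct)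
  case (start x)
  then have "chain K \<delta> e x x 0 0" by (intro chain.start)
  with start show ?case by (intro exI[of _ x] exI[of _ 0]) auto
next
  case (step x y l h z)
  show ?case
  proof (cases "t \<le> l")
    case True
    with step.IH step.prems obtain w l1 h1 l2 h2 where
      "chain K \<delta> e x w l1 h1" "chain K \<delta> e w y l2 h2" "l = l1 + l2" "h = h1 + h2" "\<bar>l1 - t\<bar> \<le> \<delta>"
      by blast
    moreover have "chain K \<delta> e w z (l2 + norm (z - y)) (h2 + e y z)"
      by (rule chain.step) fact+
    ultimately show ?thesis
      by (intro exI[of _ w] exI[of _ l1] exI[of _ h1] exI[of _ "l2 + norm (z - y)"] exI[of _ "h2 + e y z"]) auto
  next
    case False
    have "chain K \<delta> e x z (l + norm (z - y)) (h + e y z)" by (rule chain.step) fact+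
    moreover have "chain K \<delta> e z z 0 0" by (rule chain.start) fact
    moreover have "\<bar>l + norm (z - y) - t\<bar> \<le> \<delta>" using False step.hyps step.prems by linarith
    ultimately show ?thesis
      by (intro exI[of _ z] exI[of _ "l + norm (z - y)"] exI[of _ "h + e y z"] exI[of _ 0]) auto
  qed
qed

text \<open>The price of a step, less the increment of \<open>H\<close>. Differentiability of \<open>H\<close> at a point \<open>p\<close> makes it
  positive near \<open>p\<close>, but only for steps that are not short compared with their distance to \<open>p\<close>.\<close>

definition excess :: "('a::euclidean_space \<Rightarrow> real) \<Rightarrow> ('a \<Rightarrow> 'a) \<Rightarrow> real \<Rightarrow> 'a \<Rightarrow> 'a \<Rightarrow> real" where
  "excess H F \<eta> y z = F y \<bullet> (z - y) + \<eta> * norm (z - y) - (H z - H y)"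

text \<open>If the field is within \<open>\<eta>'\<close> of a constant vector \<open>v\<close> along the chain, the main terms telescope to
  \<open>v \<bullet> (y - x)\<close>, and the error uses up the part \<open>\<eta>'\<close> of the surcharge \<open>\<eta>\<close>.\<close>

lemma chain_excess_lower_bound:
  assumes "chain K \<delta> (excess H F \<eta>) x y l h"
    and "\<And>q. q \<in> K \<Longrightarrow> norm (q - x) \<le> l \<Longrightarrow> norm (F q - v) \<le> \<eta>'"
  shows "h \<ge> v \<bullet> (y - x) + (\<eta> - \<eta>') * l - (H y - H x)"
  using assms
proof (induction rule: chain.induct)
  case (step x y l h z)
  have "y \<in> K" "norm (y - x) \<le> l" using chain_endpoints[OF step.hyps(1)] by auto
  moreover from this have "norm (y - x) \<le> l + norm (z - y)" using norm_ge_zero[of "z - y"] by linarith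
  ultimately have "norm (F y - v) \<le> \<eta>'" by (intro step.prems)
  then have "norm (F y - v) * norm (z - y) \<le> \<eta>' * norm (z - y)" by (rule mult_right_mono) simp
  then have "(v - F y) \<bullet> (z - y) \<le> \<eta>' * norm (z - y)"
    using norm_cauchy_schwarz[of "v - F y" "z - y"] by (simp add: norm_minus_commute)
  moreover have "h \<ge> v \<bullet> (y - x) + (\<eta> - \<eta>') * l - (H y - H x)"
  proof (rule step.IH)
    fix q assume "q \<in> K" "norm (q - x) \<le> l"
    then show "norm (F q - v) \<le> \<eta>'" using norm_ge_zero[of "z - y"] by (intro step.prems) linarith+
  qed
  ultimately show ?case by (simp add: excess_def algebra_simps)
qed simp

text \<open>Costs and lengths are additive, so one of the two parts of a negative chain is negative. Cutting
  off pieces of length about \<open>3/2\<close> bounds the length of a negative chain from above and below,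
  which compactness arguments require.\<close>

lemma chain_cut:
  assumes "chain K \<delta> e x y l h" "1 \<le> l" "h < 0" "0 \<le> \<delta>" "\<delta> \<le> 1/2"
  shows "\<exists>x y l h. chain K \<delta> e x y l h \<and> 1 \<le> l \<and> l \<le> 3 \<and> h < 0"
proof -
  have "\<exists>x y l h. chain K \<delta> e x y l h \<and> 1 \<le> l \<and> l \<le> 3 \<and> h < 0"
    if "chain K \<delta> e x y l h" "1 \<le> l" "l \<le> real n + 3" "h < 0" for n x y l h
    using that
  proof (induction n arbitrary: x l h)
    case 0
    then show ?case by auto
  next
    case (Suc n)
    show ?case
    proof (cases "l \<le> 3")
      case False
      then obtain z l1 h1 l2 h2 where s: "chain K \<delta> e x z l1 h1" "chain K \<delta> e z y l2 h2"
        "l = l1 + l2" "h = h1 + h2" "\<bar>l1 - 3/2\<bar> \<le> \<delta>"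
        using chain_split[OF Suc.prems(1), of "3/2"] assms by auto
      show ?thesis
      proof (cases "h1 < 0")
        case True
        with s assms show ?thesis by (intro exI[of _ x] exI[of _ z] exI[of _ l1] exI[of _ h1]) (auto simp: abs_if split: if_splits)
      next
        case h1: False
        show ?thesis
          by (rule Suc.IH[OF s(2)]) (use s(3-5) h1 Suc.prems False assms in \<open>auto simp: abs_if split: if_splits\<close>)
      qed
    qed (use Suc.prems in blast)
  qed
  moreover obtain n where "l \<le> real n" using real_arch_simple by blast
  ultimately show ?thesis using assms(1-3) by (meson add_increasing2 zero_le_numeral)
qed

text \<open>Call \<open>(x, L)\<close> bad if arbitrarily fine chains that start near \<open>x\<close> and have length near \<open>L\<close> have an excess
  at most slightly above zero. If the claim fails, \<open>chain_cut\<close> and compactness yield a bad pair with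
  \<open>L \<ge> 1\<close>. Cutting chains in the middle shows that a bad \<open>(x, L)\<close> leads to a bad \<open>(z, L/2)\<close> with
  \<open>z\<close> within \<open>L/2\<close> of \<open>x\<close>, because one of the halves has small excess. Iterating gives bad pairs
  at all scales \<open>L/2\<^sup>n\<close> whose first points converge to some \<open>p\<close> in \<open>K\<close> at the same rate.
  Near \<open>p\<close>, however, the surcharge \<open>\<eta> l\<close> of such a chain dominates both the variation of \<open>F\<close> and
  the Taylor remainder of \<open>H\<close>, since its distance from \<open>p\<close> is at most a fixed multiple of \<open>l\<close>.\<close>

lemma no_long_negative_chain:
  fixes K :: "'a::euclidean_space set"
  assumes K: "compact K" and F: "continuous_on K F" and "\<eta> > 0"
    and der: "\<And>x. x \<in> K \<Longrightarrow> (H has_derivative (\<lambda>v. v \<bullet> F x)) (at x within K)"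
  shows "\<exists>\<delta>>0. \<forall>x y l h. chain K \<delta> (excess H F \<eta>) x y l h \<longrightarrow> 1 \<le> l \<longrightarrow> 0 \<le> h"
proof (rule ccontr)
  assume neg: "\<not> ?thesis"
  define ch where "ch \<delta> = chain K \<delta> (excess H F \<eta>)" for \<delta>
  define \<delta> where "\<delta> n = 1 / real (n + 2)" for n
  have \<delta>: "\<delta> n > 0" "\<delta> n \<le> 1/2" for n by (auto simp: \<delta>_def field_simps)
  have \<delta>_lim: "\<delta> \<longlonglongrightarrow> 0"
    unfolding \<delta>_def[abs_def] by real_asymp
  define bad where "bad x L \<longleftrightarrow> (\<forall>\<epsilon>>0. \<exists>x' y l h. ch \<epsilon> x' y l h \<and> norm (x' - x) \<le> \<epsilon> \<and> \<bar>l - L\<bar> \<le> \<epsilon> \<and> h \<le> \<epsilon>)"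
    for x L
  have badI: "bad x L"
    if c: "\<And>n. ch (\<delta> n) (a n) (b n) (l n) (h n)" "\<And>n. h n \<le> \<delta> n"
      and r: "strict_mono r" and lim: "(\<lambda>n. a (r n)) \<longlonglongrightarrow> x" "(\<lambda>n. l (r n)) \<longlonglongrightarrow> L" for x L a b l h and r :: "nat \<Rightarrow> nat"
    unfolding bad_def
  proof (intro allI impI)
    fix \<epsilon> :: real assume "\<epsilon> > 0"
    have "(\<lambda>n. \<delta> (r n)) \<longlonglongrightarrow> 0" using LIMSEQ_subseq_LIMSEQ[OF \<delta>_lim r] by (simp add: o_def)
    then have "\<forall>\<^sub>F n in sequentially. \<delta> (r n) < \<epsilon>" using \<open>\<epsilon> > 0\<close> by (rule order_tendstoD(2))
    moreover have "\<forall>\<^sub>F n in sequentially. dist (a (r n)) x < \<epsilon>" "\<forall>\<^sub>F n in sequentially. dist (l (r n)) L < \<epsilon>"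
      using lim \<open>\<epsilon> > 0\<close> by (auto intro: tendstoD)
    ultimately have "\<forall>\<^sub>F n in sequentially. \<delta> (r n) < \<epsilon> \<and> dist (a (r n)) x < \<epsilon> \<and> dist (l (r n)) L < \<epsilon>"
      by (intro eventually_conj)
    then obtain n where n: "\<delta> (r n) < \<epsilon>" "dist (a (r n)) x < \<epsilon>" "dist (l (r n)) L < \<epsilon>"
      using eventually_happens'[OF sequentially_bot] by blast
    have "ch \<epsilon> (a (r n)) (b (r n)) (l (r n)) (h (r n))"
      using chain_mono[OF c(1)[of "r n", unfolded ch_def], of \<epsilon>] n by (simp add: ch_def)
    with n c(2)[of "r n"] show "\<exists>x' y l h. ch \<epsilon> x' y l h \<and> norm (x' - x) \<le> \<epsilon> \<and> \<bar>l - L\<bar> \<le> \<epsilon> \<and> h \<le> \<epsilon>"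
      by (intro exI[of _ "a (r n)"] exI[of _ "b (r n)"] exI[of _ "l (r n)"] exI[of _ "h (r n)"])
        (auto simp: dist_norm)
  qed
  have "\<exists>x\<in>K. \<exists>L\<ge>1. bad x L"
  proof -
    have "\<forall>n. \<exists>x y l h. ch (\<delta> n) x y l h \<and> 1 \<le> l \<and> l \<le> 3 \<and> h < 0"
    proof
      fix n
      obtain x y l h where "ch (\<delta> n) x y l h" "1 \<le> l" "h < 0"
        using neg \<delta>(1)[of n] unfolding ch_def by (meson not_le)
      then show "\<exists>x y l h. ch (\<delta> n) x y l h \<and> 1 \<le> l \<and> l \<le> 3 \<and> h < 0"
        using chain_cut \<delta>[of n] unfolding ch_def by (meson less_imp_le)
    qed
    then obtain a b l h where c: "\<And>n. ch (\<delta> n) (a n) (b n) (l n) (h n)" "\<And>n. 1 \<le> l n" "\<And>n. l n \<le> 3"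
      "\<And>n. h n < 0" by metis
    have "a n \<in> K" for n using chain_endpoints[OF c(1)[unfolded ch_def]] by simp
    then have "\<forall>n. (a n, l n) \<in> K \<times> {1..3}" using c by auto
    then obtain p r where p: "p \<in> K \<times> {1..3}" "strict_mono (r::nat \<Rightarrow> nat)" "((\<lambda>n. (a n, l n)) \<circ> r) \<longlonglongrightarrow> p"
      using compact_Times[OF K compact_Icc, of 1 "3::real"] unfolding compact_def by meson
    from p(3) have "(\<lambda>n. a (r n)) \<longlonglongrightarrow> fst p" "(\<lambda>n. l (r n)) \<longlonglongrightarrow> snd p"
      by (auto simp: o_def dest: tendsto_fst tendsto_snd)
    moreover have "h n \<le> \<delta> n" for n using c(4)[of n] \<delta>(1)[of n] by linarith
    ultimately have "bad (fst p) (snd p)" using c(1) p(2) by (intro badI)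
    with p(1) show ?thesis by (intro bexI[of _ "fst p"] exI[of _ "snd p"]) auto
  qed
  then obtain x0 L where x0: "x0 \<in> K" "L \<ge> 1" "bad x0 L" by blast
  have halve: "\<exists>z\<in>K. norm (z - x) \<le> M / 2 \<and> bad z (M / 2)" if "bad x M" "M > 0" for x M
  proof -
    \<comment> \<open>The tolerance must not exceed \<open>M / 2\<close>, so that the chains are long enough to be cut there.\<close>
    define \<epsilon> where "\<epsilon> n = min 1 (M / 2) * \<delta> n" for n
    have \<epsilon>: "\<epsilon> n > 0" "\<epsilon> n \<le> \<delta> n" "\<epsilon> n \<le> M / 2" for n
    proof -
      show "\<epsilon> n > 0" using \<delta>(1)[of n] \<open>M > 0\<close> by (simp add: \<epsilon>_def)
      show "\<epsilon> n \<le> \<delta> n" using \<delta>(1)[of n] by (simp add: \<epsilon>_def mult_left_le_one_le \<open>M > 0\<close> less_imp_le)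
      have "\<epsilon> n \<le> (M / 2) * 1" unfolding \<epsilon>_def using \<delta>[of n] \<open>M > 0\<close> by (intro mult_mono) auto
      then show "\<epsilon> n \<le> M / 2" by simp
    qed
    have "\<forall>n. \<exists>w y l h. ch (\<delta> n) w y l h \<and> h \<le> \<delta> n \<and> \<bar>l - M / 2\<bar> \<le> 2 * \<delta> n \<and> norm (w - x) \<le> M / 2 + 2 * \<delta> n"
    proof
      fix n
      obtain x' y l h where c: "ch (\<epsilon> n) x' y l h" "norm (x' - x) \<le> \<epsilon> n" "\<bar>l - M\<bar> \<le> \<epsilon> n" "h \<le> \<epsilon> n"
        using \<open>bad x M\<close> \<epsilon>(1)[of n] unfolding bad_def by blast
      have "M / 2 \<le> l" using c(3) \<epsilon>(3)[of n] by linarith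
      then obtain z l1 h1 l2 h2 where s: "ch (\<epsilon> n) x' z l1 h1" "ch (\<epsilon> n) z y l2 h2"
        "l = l1 + l2" "h = h1 + h2" "\<bar>l1 - M / 2\<bar> \<le> \<epsilon> n"
        using chain_split[OF c(1)[unfolded ch_def], of "M / 2"] \<epsilon>(1)[of n] \<open>M > 0\<close> unfolding ch_def by auto
      have s': "ch (\<delta> n) x' z l1 h1" "ch (\<delta> n) z y l2 h2"
        using s(1,2) \<epsilon>(2)[of n] unfolding ch_def by (auto intro: chain_mono)
      have len: "norm (z - x') \<le> l1" using chain_endpoints[OF s(1)[unfolded ch_def]] by simp
      show "\<exists>w y l h. ch (\<delta> n) w y l h \<and> h \<le> \<delta> n \<and> \<bar>l - M / 2\<bar> \<le> 2 * \<delta> n \<and> norm (w - x) \<le> M / 2 + 2 * \<delta> n"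
      proof (cases "h1 \<le> \<delta> n")
        case True
        with s'(1) s(5) c(2) \<epsilon>[of n] \<delta>(1)[of n] \<open>M > 0\<close> show ?thesis
          by (intro exI[of _ x'] exI[of _ z] exI[of _ l1] exI[of _ h1]) auto
      next
        case False
        have "norm (z - x) \<le> l1 + \<epsilon> n"
          using norm_triangle_ineq[of "z - x'" "x' - x"] len c(2) by simp
        then have "norm (z - x) \<le> M / 2 + 2 * \<delta> n" using s(5) \<epsilon>(2)[of n] by linarith
        moreover have "h2 \<le> \<delta> n" "\<bar>l2 - M / 2\<bar> \<le> 2 * \<delta> n"
          using False s(3-5) c(3,4) \<epsilon>(2)[of n] \<delta>(1)[of n] by linarith+
        ultimately show ?thesis using s'(2) by blast
      qed
    qed
    then obtain a b l h where c: "\<And>n. ch (\<delta> n) (a n) (b n) (l n) (h n)" "\<And>n. h n \<le> \<delta> n"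
      "\<And>n. \<bar>l n - M / 2\<bar> \<le> 2 * \<delta> n" "\<And>n. norm (a n - x) \<le> M / 2 + 2 * \<delta> n" by metis
    have "\<forall>n. a n \<in> K" using chain_endpoints[OF c(1)[unfolded ch_def]] by simp
    then obtain z r where z: "z \<in> K" "strict_mono (r::nat \<Rightarrow> nat)" "(a \<circ> r) \<longlonglongrightarrow> z"
      using K unfolding compact_def by meson
    have \<delta>r: "(\<lambda>n. 2 * \<delta> (r n)) \<longlonglongrightarrow> 2 * 0"
      using LIMSEQ_subseq_LIMSEQ[OF \<delta>_lim z(2)] by (intro tendsto_mult tendsto_const) (simp add: o_def)
    have "(\<lambda>n. l (r n) - M / 2) \<longlonglongrightarrow> 0"
      by (rule Lim_null_comparison[where g = "\<lambda>n. 2 * \<delta> (r n)"]) (use \<delta>r c(3) in auto)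
    then have "(\<lambda>n. l (r n)) \<longlonglongrightarrow> M / 2" by (simp add: LIM_zero_iff)
    then have "bad z (M / 2)" using badI[OF c(1,2) z(2)] z(3) by (simp add: o_def)
    moreover have "norm (z - x) \<le> M / 2 + 2 * 0"
    proof (rule LIMSEQ_le)
      show "(\<lambda>n. norm (a (r n) - x)) \<longlonglongrightarrow> norm (z - x)"
        using z(3) by (intro tendsto_intros) (simp add: o_def)
      show "(\<lambda>n. M / 2 + 2 * \<delta> (r n)) \<longlonglongrightarrow> M / 2 + 2 * 0"
        by (intro tendsto_add tendsto_const \<delta>r)
    qed (use c(4) in blast)
    ultimately show ?thesis using z(1) by auto
  qed
  have "\<exists>x. \<forall>n. (x n \<in> K \<and> bad (x n) (L / 2 ^ n)) \<and> norm (x (Suc n) - x n) \<le> L / 2 ^ Suc n"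
  proof (rule dependent_nat_choice)
    show "\<exists>x. x \<in> K \<and> bad x (L / 2 ^ 0)" using x0 by auto
    fix x n assume "x \<in> K \<and> bad x (L / 2 ^ n)"
    then obtain z where "z \<in> K" "norm (z - x) \<le> L / 2 ^ n / 2" "bad z (L / 2 ^ n / 2)"
      using halve[of x "L / 2 ^ n"] x0(2) by auto
    then show "\<exists>z. (z \<in> K \<and> bad z (L / 2 ^ Suc n)) \<and> norm (z - x) \<le> L / 2 ^ Suc n"
      by (intro exI[of _ z]) (simp add: mult.commute)
  qed
  then obtain x where x: "\<And>n. x n \<in> K" "\<And>n. bad (x n) (L / 2 ^ n)"
      "\<And>n. norm (x (Suc n) - x n) \<le> L / 2 ^ Suc n" by blast
  obtain p r where p: "p \<in> K" "strict_mono (r::nat \<Rightarrow> nat)" "(x \<circ> r) \<longlonglongrightarrow> p"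
    using K x(1) unfolding compact_def by meson
  have tail: "norm (x (n + k) - x n) \<le> L / 2 ^ n - L / 2 ^ (n + k)" for n k
  proof (induction k)
    case (Suc k)
    have "norm (x (n + Suc k) - x n) \<le> norm (x (Suc (n + k)) - x (n + k)) + norm (x (n + k) - x n)"
      using norm_triangle_ineq[of "x (Suc (n + k)) - x (n + k)" "x (n + k) - x n"] by simp
    also have "\<dots> \<le> L / 2 ^ Suc (n + k) + (L / 2 ^ n - L / 2 ^ (n + k))"
      by (intro add_mono x(3) Suc.IH)
    also have "\<dots> = L / 2 ^ n - L / 2 ^ (n + Suc k)" by (simp add: field_simps)
    finally show ?case .
  qed simp
  have near: "norm (p - x n) \<le> L / 2 ^ n" for n
  proof (rule LIMSEQ_le_const2)
    show "(\<lambda>k. norm (x (r k) - x n)) \<longlonglongrightarrow> norm (p - x n)"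
      using p(3) by (intro tendsto_intros) (simp add: o_def)
    show "\<exists>N. \<forall>k\<ge>N. norm (x (r k) - x n) \<le> L / 2 ^ n"
    proof (intro exI[of _ n] allI impI)
      fix k assume "n \<le> k"
      then have "n \<le> r k" using seq_suble[OF p(2), of k] by linarith
      then have "norm (x (r k) - x n) \<le> L / 2 ^ n - L / 2 ^ r k" using tail[of n "r k - n"] by simp
      moreover have "0 \<le> L / 2 ^ r k" using x0(2) by simp
      ultimately show "norm (x (r k) - x n) \<le> L / 2 ^ n" by linarith
    qed
  qed
  obtain r1 where r1: "r1 > 0" "\<And>q. \<lbrakk>q \<in> K; norm (q - p) < r1\<rbrakk> \<Longrightarrow> norm (F q - F p) < \<eta> / 2"
    using F[unfolded continuous_on_iff, rule_format, OF p(1), of "\<eta> / 2"] \<open>\<eta> > 0\<close> by (auto simp: dist_norm)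
  obtain r2 where r2: "r2 > 0"
    "\<And>q. \<lbrakk>q \<in> K; norm (q - p) < r2\<rbrakk> \<Longrightarrow> norm (H q - H p - (q - p) \<bullet> F p) \<le> \<eta> / 48 * norm (q - p)"
    using der[OF p(1)] \<open>\<eta> > 0\<close> unfolding has_derivative_within_alt by (meson divide_pos_pos zero_less_numeral)
  \<comment> \<open>Within distance \<open>\<rho>\<close> of \<open>p\<close>, half of the surcharge \<open>\<eta>\<close> absorbs the variation of \<open>F\<close>. The other
    half contributes at least \<open>\<eta> M / 4\<close> over a chain of length at least \<open>M / 2\<close>. This exceeds
    the Taylor remainders at both ends, at most \<open>\<eta> M / 16 + \<eta> M / 32\<close> because the ends lie within
    \<open>3 M\<close> and \<open>3 M / 2\<close> of \<open>p\<close>, together with the tolerance \<open>\<eta> M / 16\<close>.\<close>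
  define \<rho> where "\<rho> = min r1 r2"
  have "\<rho> > 0" using r1 r2 by (simp add: \<rho>_def)
  have "(\<lambda>n. 4 * (L / 2 ^ n)) \<longlonglongrightarrow> 0" by real_asymp
  then have "\<forall>\<^sub>F n in sequentially. 4 * (L / 2 ^ n) < \<rho>" using \<open>\<rho> > 0\<close> by (rule order_tendstoD(2))
  then obtain n where n: "4 * (L / 2 ^ n) < \<rho>" using eventually_happens'[OF sequentially_bot] by blast
  define M where "M = L / 2 ^ n"
  have M: "M > 0" "4 * M < \<rho>" using x0(2) n by (auto simp: M_def)
  define \<epsilon> where "\<epsilon> = min (1/2) (\<eta> / 16) * M"
  have "\<epsilon> \<le> 1/2 * M" unfolding \<epsilon>_def using M(1) by (intro mult_right_mono) auto
  moreover have "\<epsilon> \<le> \<eta> / 16 * M" unfolding \<epsilon>_def using M(1) by (intro mult_right_mono) auto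
  moreover have "\<epsilon> > 0" unfolding \<epsilon>_def using M(1) \<open>\<eta> > 0\<close> by simp
  ultimately have \<epsilon>: "\<epsilon> > 0" "\<epsilon> \<le> M / 2" "\<epsilon> \<le> \<eta> * M / 16" by simp_all
  obtain a b l h where c: "ch \<epsilon> a b l h" "norm (a - x n) \<le> \<epsilon>" "\<bar>l - M\<bar> \<le> \<epsilon>" "h \<le> \<epsilon>"
    using x(2)[of n] \<epsilon>(1) unfolding bad_def M_def by blast
  have ab: "a \<in> K" "b \<in> K" "norm (b - a) \<le> l" using chain_endpoints[OF c(1)[unfolded ch_def]] by auto
  have l: "M / 2 \<le> l" "l \<le> 3 / 2 * M" using c(3) \<epsilon>(2) by linarith+
  have ap: "norm (a - p) \<le> 3 / 2 * M"
    using norm_triangle_ineq4[of "a - x n" "p - x n"] near[of n] c(2) \<epsilon>(2) by (simp add: M_def)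
  have bp: "norm (q - p) \<le> 3 * M" if "norm (q - a) \<le> l" for q
    using norm_triangle_ineq[of "q - a" "a - p"] that ap l by simp
  have "h \<ge> F p \<bullet> (b - a) + (\<eta> - \<eta> / 2) * l - (H b - H a)"
  proof (rule chain_excess_lower_bound[OF c(1)[unfolded ch_def]])
    fix q assume "q \<in> K" "norm (q - a) \<le> l"
    then show "norm (F q - F p) \<le> \<eta> / 2"
      using r1(2)[of q] bp[of q] M by (auto simp: \<rho>_def)
  qed
  moreover have "\<bar>H b - H p - (b - p) \<bullet> F p\<bar> \<le> \<eta> / 48 * (3 * M)"
  proof -
    have "\<bar>H b - H p - (b - p) \<bullet> F p\<bar> \<le> \<eta> / 48 * norm (b - p)"
      using r2(2)[OF ab(2)] bp[OF ab(3)] M by (auto simp: \<rho>_def)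
    also have "\<dots> \<le> \<eta> / 48 * (3 * M)" using bp[OF ab(3)] \<open>\<eta> > 0\<close> by (intro mult_left_mono) auto
    finally show ?thesis .
  qed
  moreover have "\<bar>H a - H p - (a - p) \<bullet> F p\<bar> \<le> \<eta> / 48 * (3 / 2 * M)"
  proof -
    have "\<bar>H a - H p - (a - p) \<bullet> F p\<bar> \<le> \<eta> / 48 * norm (a - p)"
      using r2(2)[OF ab(1)] ap M by (auto simp: \<rho>_def)
    also have "\<dots> \<le> \<eta> / 48 * (3 / 2 * M)" using ap \<open>\<eta> > 0\<close> by (intro mult_left_mono) auto
    finally show ?thesis .
  qed
  moreover have "F p \<bullet> (b - a) = (b - p) \<bullet> F p - (a - p) \<bullet> F p"
    by (simp add: inner_diff_left inner_diff_right inner_commute)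
  moreover have "(\<eta> - \<eta> / 2) * l \<ge> \<eta> * M / 4"
    using mult_left_mono[OF l(1), of "\<eta> / 2"] \<open>\<eta> > 0\<close> by simp
  moreover have "\<eta> * M > 0" using M \<open>\<eta> > 0\<close> by simp
  moreover have "\<eta> / 48 * (3 * M) = \<eta> * M / 16" "\<eta> / 48 * (3 / 2 * M) = \<eta> * M / 32" by simp_all
  ultimately show False using c(4) \<epsilon>(3) by linarith
qed

text \<open>The value \<open>f(x) - H(x)\<close> is the infimum of the excess of chains ending at \<open>x\<close>. Long chains have
  nonnegative excess and short ones are bounded trivially, so the infimum is finite. Appending one
  step to chains gives an upper bound for \<open>f(y) - f(x)\<close>; exchanging \<open>x\<close> and \<open>y\<close> gives the lower
  bound.\<close>

proposition chain_potential:
  fixes K :: "'a::euclidean_space set"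
  assumes K: "compact K" and F: "continuous_on K F" and "\<eta> > 0"
    and der: "\<And>x. x \<in> K \<Longrightarrow> (H has_derivative (\<lambda>v. v \<bullet> F x)) (at x within K)"
  shows "\<exists>f r. r > 0 \<and> jet_on K f F r (2 * \<eta>)"
proof -
  obtain \<delta> where \<delta>: "\<delta> > 0" "\<And>x y l h. chain K \<delta> (excess H F \<eta>) x y l h \<Longrightarrow> 1 \<le> l \<Longrightarrow> 0 \<le> h"
    using no_long_negative_chain[OF assms] by blast
  have "uniformly_continuous_on K F" by (rule compact_uniformly_continuous[OF F K])
  then obtain d where d: "d > 0" "\<And>x y. \<lbrakk>x \<in> K; y \<in> K; dist y x < d\<rbrakk> \<Longrightarrow> dist (F y) (F x) < \<eta>"
    using \<open>\<eta> > 0\<close> unfolding uniformly_continuous_on_def by meson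
  have Hc: "continuous_on K H"
    using der unfolding continuous_on_eq_continuous_within by (blast intro: has_derivative_continuous)
  obtain BF where BF: "\<And>x. x \<in> K \<Longrightarrow> norm (F x) \<le> BF"
    using compact_imp_bounded[OF compact_continuous_image[OF F K]] by (auto simp: bounded_iff)
  obtain BH where BH: "\<And>x. x \<in> K \<Longrightarrow> norm (H x) \<le> BH"
    using compact_imp_bounded[OF compact_continuous_image[OF Hc K]] by (auto simp: bounded_iff)
  define E where "E x = {h. \<exists>p l. chain K \<delta> (excess H F \<eta>) p x l h}" for x
  have E_ne: "E x \<noteq> {}" if "x \<in> K" for x
    using chain.start[OF that] unfolding E_def by blast
  have E_bdd: "bdd_below (E x)" for x
  proof (rule bdd_belowI)
    fix h assume "h \<in> E x"
    then obtain p l where c: "chain K \<delta> (excess H F \<eta>) p x l h" by (auto simp: E_def)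
    have px: "p \<in> K" "x \<in> K" "norm (x - p) \<le> l" using chain_endpoints[OF c] by auto
    show "- (BF + 2 * BH) \<le> h"
    proof (cases "1 \<le> l")
      case True
      have "0 \<le> BF" "0 \<le> BH" using BF[OF px(1)] BH[OF px(1)] norm_ge_zero order_trans by blast+
      with \<delta>(2)[OF c True] show ?thesis by linarith
    next
      case False
      have l0: "0 \<le> l" using px(3) norm_ge_zero order_trans by blast
      have "0 \<bullet> (x - p) + (\<eta> - BF) * l - (H x - H p) \<le> h"
        by (rule chain_excess_lower_bound[OF c]) (simp add: BF)
      moreover have "BF * l \<le> BF * 1" using False BF[OF px(1)] norm_ge_zero[of "F p"] by (intro mult_left_mono) linarith+
      moreover have "0 \<le> \<eta> * l" using \<open>\<eta> > 0\<close> l0 by simp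
      ultimately show ?thesis using BH[OF px(1)] BH[OF px(2)] by (simp add: algebra_simps)
    qed
  qed
  define f where "f x = H x + Inf (E x)" for x
  have upper: "f y - f x \<le> F x \<bullet> (y - x) + \<eta> * norm (y - x)"
    if "x \<in> K" "y \<in> K" "norm (y - x) \<le> \<delta>" for x y
  proof -
    have "Inf (E y) - excess H F \<eta> x y \<le> Inf (E x)"
    proof (rule cInf_greatest[OF E_ne[OF that(1)]])
      fix h assume "h \<in> E x"
      then have "h + excess H F \<eta> x y \<in> E y"
        using chain.step[OF _ that(2,3)] unfolding E_def by blast
      then show "Inf (E y) - excess H F \<eta> x y \<le> h" using cInf_lower[OF _ E_bdd] by force
    qed
    then show ?thesis by (simp add: f_def excess_def)
  qed
  show ?thesis
    unfolding jet_on_def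
  proof (intro exI[of _ f] exI[of _ "min \<delta> (d / 2)"] conjI ballI impI)
    show "min \<delta> (d / 2) > 0" using \<delta> d by simp
  next
    fix x y assume xy: "x \<in> K" "y \<in> K" "norm (x - y) \<le> min \<delta> (d / 2)"
    have F_close: "norm (F x - F y) \<le> \<eta>"
      using d(2)[OF xy(2,1)] xy(3) d(1) by (simp add: dist_norm)
    show "norm (F x - F y) \<le> 2 * \<eta>" using F_close \<open>\<eta> > 0\<close> by simp
    have "(F x - F y) \<bullet> (x - y) \<ge> - (\<eta> * norm (x - y))"
    proof -
      have "\<bar>(F x - F y) \<bullet> (x - y)\<bar> \<le> norm (F x - F y) * norm (x - y)" by (rule Cauchy_Schwarz_ineq2)
      also have "\<dots> \<le> \<eta> * norm (x - y)" using F_close by (rule mult_right_mono) simp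
      finally show ?thesis by linarith
    qed
    moreover have "f x - f y \<le> F y \<bullet> (x - y) + \<eta> * norm (x - y)"
      by (rule upper) (use xy in auto)
    moreover have "f y - f x \<le> F x \<bullet> (y - x) + \<eta> * norm (y - x)"
      by (rule upper) (use xy in \<open>auto simp: norm_minus_commute\<close>)
    moreover have "0 \<le> \<eta> * norm (x - y)" using \<open>\<eta> > 0\<close> by simp
    ultimately have "\<bar>f x - f y - F y \<bullet> (x - y)\<bar> \<le> 2 * \<eta> * norm (x - y)"
      by (simp add: norm_minus_commute inner_diff_left inner_diff_right abs_le_iff)
    then show "\<bar>f x - f y - F y \<bullet> (x - y)\<bar> \<le> 2 * \<eta> * norm (x - y)" .
  qed
qed

section \<open>Networks approximate gradients\<close>

lemma neural_networks_add:
  assumes "f \<in> neural_networks \<sigma>" "g \<in> neural_networks \<sigma>"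
  shows "(\<lambda>x. f x + g x) \<in> neural_networks \<sigma>"
proof -
  obtain q a b \<beta> where f: "f = (\<lambda>x. \<Sum>j=1..q::nat. \<sigma> (a j \<bullet> x + b j) *\<^sub>R \<beta> j)"
    using assms(1) by (auto simp: neural_networks_def simp del: One_nat_def)
  obtain r c d \<gamma> where g: "g = (\<lambda>x. \<Sum>j=1..r::nat. \<sigma> (c j \<bullet> x + d j) *\<^sub>R \<gamma> j)"
    using assms(2) by (auto simp: neural_networks_def simp del: One_nat_def)
  define A B C where "A j = (if j \<le> q then a j else c (j - q))"
    and "B j = (if j \<le> q then b j else d (j - q))"
    and "C j = (if j \<le> q then \<beta> j else \<gamma> (j - q))" for j
  have "f x + g x = (\<Sum>j=1..q + r. \<sigma> (A j \<bullet> x + B j) *\<^sub>R C j)" for x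
  proof -
    have "(\<Sum>j=1..q + r. \<sigma> (A j \<bullet> x + B j) *\<^sub>R C j)
      = (\<Sum>j=1..q. \<sigma> (A j \<bullet> x + B j) *\<^sub>R C j) + (\<Sum>j=q + 1..q + r. \<sigma> (A j \<bullet> x + B j) *\<^sub>R C j)"
      by (rule sum.ub_add_nat) simp
    also have "(\<Sum>j=q + 1..q + r. \<sigma> (A j \<bullet> x + B j) *\<^sub>R C j)
      = (\<Sum>j=1..r. \<sigma> (A (j + q) \<bullet> x + B (j + q)) *\<^sub>R C (j + q))"
      using sum.shift_bounds_cl_nat_ivl[of "\<lambda>j. \<sigma> (A j \<bullet> x + B j) *\<^sub>R C j" 1 q r] by (simp add: add.commute)
    finally show ?thesis by (simp add: f g A_def B_def C_def)
  qed
  then show ?thesis unfolding neural_networks_def by blast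
qed

text \<open>Linear maps act on the output weights. This covers scalar multiples, and it also turns scalar
  networks into the components of vector-valued ones.\<close>

lemma neural_networks_linear:
  assumes "f \<in> neural_networks \<sigma>" "linear L"
  shows "(\<lambda>x. L (f x)) \<in> neural_networks \<sigma>"
proof -
  obtain q a b \<beta> where f: "f = (\<lambda>x. \<Sum>j=1..q::nat. \<sigma> (a j \<bullet> x + b j) *\<^sub>R \<beta> j)"
    using assms(1) by (auto simp: neural_networks_def simp del: One_nat_def)
  have "(\<lambda>x. L (f x)) = (\<lambda>x. \<Sum>j=1..q::nat. \<sigma> (a j \<bullet> x + b j) *\<^sub>R L (\<beta> j))"
    by (simp add: f linear_sum[OF assms(2)] linear_scale[OF assms(2)])
  then show ?thesis unfolding neural_networks_def by fast
qed

lemma neural_networks_zero: "(\<lambda>_. 0) \<in> neural_networks \<sigma>"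
  unfolding neural_networks_def by (intro CollectI exI[of _ "0::nat"]) simp

lemma neural_networks_neuron: "(\<lambda>x. \<sigma> (a \<bullet> x + b)) \<in> neural_networks \<sigma>"
  unfolding neural_networks_def
  by (intro CollectI exI[of _ "1::nat"] exI[of _ "\<lambda>_. a"] exI[of _ "\<lambda>_. b"] exI[of _ "\<lambda>_. 1::real"]) simp

lemma neural_networks_sum:
  assumes "finite I" "\<And>i. i \<in> I \<Longrightarrow> f i \<in> neural_networks \<sigma>"
  shows "(\<lambda>x. \<Sum>i\<in>I. f i x) \<in> neural_networks \<sigma>"
  using assms
proof (induction I)
  case (insert i I)
  have "(\<lambda>x. f i x + (\<Sum>i\<in>I. f i x)) \<in> neural_networks \<sigma>"
    by (rule neural_networks_add) (use insert in auto)
  then show ?case using insert.hyps by simp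
qed (simp add: neural_networks_zero)

text \<open>The three constructions combined: \<open>F\<close> has a potential up to the relative error \<open>2 \<zeta>\<close>, whose
  jet is glued to a limit of polynomials with gradient within \<open>2 C \<zeta> = \<eta> / 2\<close> of \<open>F\<close>; polynomials
  are limits of networks, and choosing one network costs another \<open>\<eta> / 2\<close>.\<close>

theorem network_gradient_approximation:
  fixes K :: "(real^'n) set"
  assumes K: "compact K" and F: "continuous_on K F"
    and der: "\<And>x. x \<in> K \<Longrightarrow> (H has_derivative (\<lambda>v. v \<bullet> F x)) (at x within K)"
    and \<sigma>: "\<sigma> \<in> S12" "\<sigma> \<noteq> (\<lambda>_. 0)" and "\<eta> > 0"
  shows "\<exists>G\<in>neural_networks \<sigma>. \<exists>G'. has_C1_gradient G G' \<and> (\<forall>x\<in>K. norm (G' x - F x) < \<eta>)"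
proof -
  have C1: "is_C1 \<sigma>"
    using \<sigma>(1) unfolding S12_def is_C1_def C1_differentiable_on_def has_real_derivative_iff_has_vector_derivative
    by auto
  have L2: "square_integrable_on \<sigma> UNIV" using \<sigma>(1) by (simp add: S12_def)
  obtain C where C: "C > 0" "\<And>(K::(real^'n) set) f F r \<eta>. \<lbrakk>bounded K; r > 0; \<eta> \<ge> 0; jet_on K f F r \<eta>\<rbrakk> \<Longrightarrow>
      \<exists>G G'. C1_limit polynomials G G' \<and> (\<forall>x\<in>K. norm (G' x - F x) \<le> C * \<eta>)"
    using C1_limit_of_jet[where 'a = "real^'n"] by blast
  define \<zeta> where "\<zeta> = \<eta> / (4 * C)"
  have \<zeta>: "\<zeta> > 0" "C * (2 * \<zeta>) = \<eta> / 2" using C(1) \<open>\<eta> > 0\<close> by (auto simp: \<zeta>_def)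
  obtain f r where "r > 0" "jet_on K f F r (2 * \<zeta>)"
    using chain_potential[OF K F \<zeta>(1) der] by blast
  then have "\<exists>G G'. C1_limit polynomials G G' \<and> (\<forall>x\<in>K. norm (G' x - F x) \<le> C * (2 * \<zeta>))"
    using C(2)[OF compact_imp_bounded[OF K]] \<zeta>(1) by simp
  then obtain G G' where G: "C1_limit polynomials G G'" "\<And>x. x \<in> K \<Longrightarrow> norm (G' x - F x) \<le> \<eta> / 2"
    unfolding \<zeta>(2) by blast
  have lim: "C1_limit (neural_networks \<sigma>) G G'"
  proof (rule C1_limit_mono[OF G(1)])
    fix g :: "real^'n \<Rightarrow> real" and g' assume g: "g \<in> polynomials" "has_C1_gradient g g'"
    have "g \<in> C1_closure (neural_networks \<sigma>)"
    proof (rule polynomial_in_C1_closure[OF _ _ _ C1])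
      show "(\<lambda>x. c * f x) \<in> neural_networks \<sigma>" if "f \<in> neural_networks \<sigma>" for c and f :: "real^'n \<Rightarrow> real"
        using neural_networks_linear[OF that, of "(*) c"] by (simp add: linear_times)
      show "(unit_difference ^^ k) \<sigma> \<noteq> (\<lambda>_. 0)" for k
        by (rule unit_difference_power_nonzero[OF C1 L2 \<sigma>(2)])
      show "real_polynomial_function g" using g by simp
    qed (auto intro: neural_networks_add neural_networks_zero neural_networks_neuron)
    then show "C1_limit (neural_networks \<sigma>) g g'" using g(2) by (rule C1_closure_limit)
  qed
  obtain R where R: "\<And>x. x \<in> K \<Longrightarrow> norm x \<le> R"
    using compact_imp_bounded[OF K] by (auto simp: bounded_iff)
  have "\<eta> / 2 > 0" using \<open>\<eta> > 0\<close> by simp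
  with lim obtain N N' where N: "N \<in> neural_networks \<sigma>" "has_C1_gradient N N'"
    "\<forall>x\<in>cball 0 R. \<bar>N x - G x\<bar> < \<eta> / 2 \<and> norm (N' x - G' x) < \<eta> / 2"
    unfolding C1_limit_def by blast
  have "norm (N' x - F x) < \<eta>" if "x \<in> K" for x
  proof -
    have "norm (N' x - G' x) < \<eta> / 2" using N(3) R[OF that] by simp
    then show ?thesis using norm_triangle_ineq[of "N' x - G' x" "G' x - F x"] G(2)[OF that] by simp
  qed
  with N show ?thesis by blast
qed

section \<open>The transformed field\<close>

lemma matrix_inv_works:
  assumes "invertible (A::real^'n^'n)"
  shows "A ** matrix_inv A = mat 1" "matrix_inv A ** A = mat 1"
  using assms unfolding invertible_def matrix_inv_def by (metis (mono_tags, lifting) someI_ex)+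

text \<open>Cramer's rule exhibits the entries of the inverse as quotients of determinants, which gives its
  continuity.\<close>

lemma matrix_inv_cramer:
  fixes A :: "real^'n^'n"
  assumes "det A \<noteq> 0"
  shows "matrix_inv A $ k $ j = det (\<chi> r c. if c = k then axis j 1 $ r else A $ r $ c) / det A"
proof -
  have "A ** matrix_inv A = mat 1" using assms by (simp add: invertible_det_nz matrix_inv_works)
  then have "A *v (matrix_inv A *v axis j 1) = axis j 1" by (simp add: matrix_vector_mul_assoc)
  then have "matrix_inv A *v axis j 1 = (\<chi> k. det (\<chi> r c. if c = k then axis j 1 $ r else A $ r $ c) / det A)"
    by (simp add: cramer[OF assms])
  moreover have "(matrix_inv A *v axis j 1) $ k = matrix_inv A $ k $ j"
    by (simp add: matrix_vector_mult_basis column_def)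
  ultimately show ?thesis by simp
qed

lemma continuous_on_det [continuous_intros]:
  fixes A :: "'a::topological_space \<Rightarrow> real^'n^'n"
  assumes "continuous_on X A"
  shows "continuous_on X (\<lambda>x. det (A x))"
  unfolding det_def using assms by (intro continuous_intros)

lemma continuous_on_matrix_inv:
  fixes A :: "'a::topological_space \<Rightarrow> real^'n^'n"
  assumes "continuous_on X A" "\<And>x. x \<in> X \<Longrightarrow> invertible (A x)"
  shows "continuous_on X (\<lambda>x. matrix_inv (A x))"
proof -
  have nz: "det (A x) \<noteq> 0" if "x \<in> X" for x using assms(2)[OF that] by (simp add: invertible_det_nz)
  have "continuous_on X (\<lambda>x. if c = k then axis j 1 $ r else A x $ r $ c)" for c k j r
    using assms(1) by (cases "c = k") (auto intro!: continuous_intros)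
  then have "continuous_on X (\<lambda>x. \<chi> k j. det (\<chi> r c. if c = k then axis j 1 $ r else A x $ r $ c) / det (A x))"
    using assms(1) nz by (intro continuous_intros continuous_on_vec_lambda) auto
  then show ?thesis
    by (rule continuous_on_eq) (auto simp: vec_eq_iff matrix_inv_cramer nz)
qed

lemma continuous_on_transformed:
  fixes A :: "'a::topological_space \<Rightarrow> real^'n^'n" and v :: "'a \<Rightarrow> real^'n"
  assumes "continuous_on X A" "continuous_on X v" "\<And>x. x \<in> X \<Longrightarrow> invertible (A x)"
  shows "continuous_on X (\<lambda>x. (matrix_inv (A x) ** S ** transpose (matrix_inv (A x))) *v v x)"
  unfolding matrix_vector_mult_def matrix_matrix_mult_def transpose_def
  using continuous_on_matrix_inv[OF assms(1,3)] assms(2)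
  by (auto intro!: continuous_intros continuous_on_vec_lambda)

text \<open>A continuous function is uniformly continuous at the points of a compact set with respect to all
  nearby points, including those outside of the set: it is uniformly continuous on a compact
  neighbourhood.\<close>

lemma continuous_on_uniform_near_compact:
  fixes g :: "'a::euclidean_space \<Rightarrow> 'b::metric_space"
  assumes Z: "compact Z" and U: "open U" "Z \<subseteq> U" and g: "continuous_on U g" and "e > 0"
  shows "\<exists>\<eta>>0. \<forall>z\<in>Z. \<forall>w. dist w z < \<eta> \<longrightarrow> w \<in> U \<and> dist (g w) (g z) < e"
proof -
  obtain r where r: "r > 0" "(\<Union>z\<in>Z. cball z r) \<subseteq> U"
    using compact_subset_open_imp_cball_epsilon_subset[OF Z U] by blast
  have "compact {z + w |z w. z \<in> Z \<and> w \<in> cball 0 r}" by (intro compact_sums Z compact_cball)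
  moreover have "{z + w |z w. z \<in> Z \<and> w \<in> cball 0 r} = (\<Union>z\<in>Z. cball z r)"
  proof (intro equalityI subsetI)
    fix y assume "y \<in> (\<Union>z\<in>Z. cball z r)"
    then obtain z where "z \<in> Z" "dist z y \<le> r" by auto
    then show "y \<in> {z + w |z w. z \<in> Z \<and> w \<in> cball 0 r}"
      by (intro CollectI exI[of _ z] exI[of _ "y - z"]) (auto simp: dist_norm norm_minus_commute)
  next
    fix y assume "y \<in> {z + w |z w. z \<in> Z \<and> w \<in> cball 0 r}"
    then obtain z w where "z \<in> Z" "norm w \<le> r" "y = z + w" by auto
    then show "y \<in> (\<Union>z\<in>Z. cball z r)" by (intro UN_I[of z]) (auto simp: dist_norm)
  qed
  ultimately have "uniformly_continuous_on (\<Union>z\<in>Z. cball z r) g"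
    by (intro compact_uniformly_continuous continuous_on_subset[OF g r(2)]) simp
  then obtain d where d: "d > 0"
    "\<And>z w. \<lbrakk>z \<in> (\<Union>z\<in>Z. cball z r); w \<in> (\<Union>z\<in>Z. cball z r); dist w z < d\<rbrakk> \<Longrightarrow> dist (g w) (g z) < e"
    using \<open>e > 0\<close> unfolding uniformly_continuous_on_def by meson
  show ?thesis
  proof (intro exI[of _ "min d r"] conjI ballI allI impI)
    fix z w assume "z \<in> Z" "dist w z < min d r"
    then have w: "z \<in> (\<Union>z\<in>Z. cball z r)" "w \<in> (\<Union>z\<in>Z. cball z r)" "dist w z < d"
      using r(1) by (auto simp: dist_commute intro!: bexI[of _ z])
    then show "w \<in> U" using r(2) by blast
    show "dist (g w) (g z) < e" by (rule d(2)[OF w])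
  qed (use d r in simp)
qed

lemma jacobian_eqI:
  fixes f :: "real^'n \<Rightarrow> real^'m"
  assumes "(f has_derivative (\<lambda>h. A *v h)) (at x)" shows "jacobian f (at x) = A"
  unfolding jacobian_def frechet_derivative_at[OF assms, symmetric] by (rule matrix_of_matrix_vector_mul)

lemma gradient_eqI:
  assumes "GDERIV f x :> v" shows "gradient f x = v"
proof -
  have "(f has_derivative (\<lambda>h. h \<bullet> v)) (at x)" using assms by (simp add: gderiv_def)
  then show ?thesis
    by (simp add: gradient_def frechet_derivative_at[symmetric] inner_axis' vec_eq_iff)
qed

lemma C1_diffeomorphism_jacobian:
  assumes "C1_diffeomorphism u"
  shows "continuous_on UNIV (\<lambda>x. jacobian u (at x))" "invertible (jacobian u (at x))"
    "(u has_derivative (\<lambda>h. jacobian u (at x) *v h)) (at x)"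
proof -
  have u: "bij u" "\<And>x. u differentiable (at x)" "\<And>y. inv u differentiable (at y)"
    and cont: "continuous_on UNIV (\<lambda>x. jacobian u (at x))"
    using assms by (auto simp: C1_diffeomorphism_def C1_map_def)
  show "continuous_on UNIV (\<lambda>x. jacobian u (at x))" by (rule cont)
  show du: "(u has_derivative (\<lambda>h. jacobian u (at x) *v h)) (at x)"
    using u(2) by (simp add: jacobian_works)
  have dv: "(inv u has_derivative (\<lambda>h. jacobian (inv u) (at (u x)) *v h)) (at (u x))"
    using u(3) by (simp add: jacobian_works)
  have "((\<lambda>x. inv u (u x)) has_derivative
      (\<lambda>h. jacobian (inv u) (at (u x)) *v (jacobian u (at x) *v h))) (at x)"
    using has_derivative_compose[OF du dv] .
  then have "((\<lambda>x. x) has_derivative (\<lambda>h. (jacobian (inv u) (at (u x)) ** jacobian u (at x)) *v h)) (at x)"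
    using u(1) by (simp add: bij_is_inj matrix_vector_mul_assoc)
  then have "(\<lambda>h. (jacobian (inv u) (at (u x)) ** jacobian u (at x)) *v h) = (\<lambda>h. h)"
    by (rule has_derivative_unique) (rule has_derivative_ident)
  then have "jacobian (inv u) (at (u x)) ** jacobian u (at x) = mat 1"
    by (simp add: matrix_eq fun_eq_iff)
  then show "invertible (jacobian u (at x))"
    using matrix_left_right_inverse unfolding invertible_def by blast
qed

lemma continuous_on_gradient:
  assumes u: "C1_diffeomorphism u" and "continuous_on K (gradient_wrt u H)"
  shows "continuous_on K (gradient H)"
proof -
  have "gradient H x = transpose (jacobian u (at x)) *v gradient_wrt u H x" for x
  proof -
    have "transpose (jacobian u (at x)) ** transpose (matrix_inv (jacobian u (at x))) = mat 1"
      using C1_diffeomorphism_jacobian(2)[OF u, of x]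
      by (simp add: matrix_transpose_mul[symmetric] matrix_inv_works transpose_mat)
    then show ?thesis by (simp add: gradient_wrt_def matrix_vector_mul_assoc del: transpose_matrix_vector)
  qed
  then have "gradient H = (\<lambda>x. transpose (jacobian u (at x)) *v gradient_wrt u H x)" by (rule ext)
  moreover have "continuous_on K (\<lambda>x. transpose (jacobian u (at x)) *v gradient_wrt u H x)"
    unfolding matrix_vector_mult_def transpose_def
    using assms(2) continuous_on_subset[OF C1_diffeomorphism_jacobian(1)[OF u] subset_UNIV[of K]]
    by (auto intro!: continuous_intros continuous_on_vec_lambda)
  ultimately show ?thesis by simp
qed

lemma L2_norm_less:
  fixes D :: "'a::euclidean_space \<Rightarrow> 'b::euclidean_space"
  assumes K: "compact K" and D: "continuous_on K D"
    and e: "e > 0" "\<And>x. x \<in> K \<Longrightarrow> norm (D x) \<le> e / (sqrt (measure lborel K) + 1)"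
  shows "square_integrable_on D K" "L2_norm K D < e"
proof -
  let ?m = "measure lborel K"
  have Kb: "K \<in> sets borel" using K by (intro borel_closed compact_imp_closed)
  have int: "integrable lborel (\<lambda>x. indicator K x *\<^sub>R (norm (D x))\<^sup>2)"
    by (rule borel_integrable_compact[OF K]) (intro continuous_intros D)
  have "(\<lambda>x. indicator K x *\<^sub>R D x) \<in> borel_measurable borel"
    by (rule borel_measurable_continuous_on_indicator[OF Kb D])
  then have "set_borel_measurable lebesgue K D"
    unfolding set_borel_measurable_def by (intro measurable_completion) simp
  moreover have "set_integrable lebesgue K (\<lambda>x. (norm (D x))\<^sup>2)"
    unfolding set_integrable_def using int by (subst integrable_completion) auto
  ultimately show "square_integrable_on D K" by (simp add: square_integrable_on_def)
  define d where "d = e / (sqrt ?m + 1)"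
  have pos: "sqrt ?m + 1 > 0" by (intro add_nonneg_pos) auto
  then have d: "d > 0" using e(1) by (simp add: d_def)
  have "(LINT x:K|lebesgue. (norm (D x))\<^sup>2) = (\<integral>x. indicator K x *\<^sub>R (norm (D x))\<^sup>2 \<partial>lborel)"
    unfolding set_lebesgue_integral_def using int by (subst integral_completion) auto
  also have "\<dots> \<le> (\<integral>x. indicator K x *\<^sub>R d\<^sup>2 \<partial>lborel)"
  proof (rule integral_mono[OF int])
    show "integrable lborel (\<lambda>x. indicator K x *\<^sub>R d\<^sup>2)"
      by (rule borel_integrable_compact[OF K]) (intro continuous_intros)
    show "indicator K x *\<^sub>R (norm (D x))\<^sup>2 \<le> indicator K x *\<^sub>R d\<^sup>2" for x
      using e(2)[of x] by (auto simp: indicator_def d_def intro!: power_mono)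
  qed
  also have "\<dots> = ?m * d\<^sup>2" using Kb by simp
  finally have "L2_norm K D \<le> sqrt (?m * d\<^sup>2)" by (simp add: L2_norm_def)
  also have "\<dots> = sqrt ?m * d" using d by (simp add: real_sqrt_mult)
  also have "\<dots> < (sqrt ?m + 1) * d" using d by simp
  also have "\<dots> = e" using pos by (simp add: d_def)
  finally show "L2_norm K D < e" .
qed

lemma norm_vec_less_of_rows:
  fixes A :: "'a::real_normed_vector ^ 'n" and e :: real
  assumes "\<And>k. norm (A $ k) < e"
  shows "norm A < CARD('n) * e"
proof -
  have "norm A \<le> (\<Sum>k\<in>UNIV. norm (A $ k))" unfolding norm_vec_def by (rule L2_set_le_sum) simp
  also have "\<dots> < (\<Sum>k\<in>(UNIV::'n set). e)" by (rule sum_strict_mono) (use assms in auto)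
  finally show ?thesis by simp
qed

theorem theorem6:
  fixes H :: "real^'n \<Rightarrow> real"
    and u :: "real^'n \<Rightarrow> real^'n"
    and S :: "real^'n^'n"
    and K :: "(real^'n) set"
    and \<sigma> \<rho> :: "real \<Rightarrow> real"
    and \<epsilon> :: real
  assumes "\<And>x. H differentiable (at x)"
    and "C1_diffeomorphism u"
    and "compact K"
    and "\<exists>L. L-lipschitz_on K (gradient_wrt u H)"
    and "\<sigma> \<in> S12" and "\<sigma> \<noteq> (\<lambda>_. 0)"
    and "\<rho> \<in> S12" and "\<rho> \<noteq> (\<lambda>_. 0)"
    and "\<epsilon> > 0"
  shows "\<exists>H_NN \<in> neural_networks \<sigma>. \<exists>u_NN \<in> neural_networks \<rho>.
           (\<forall>x\<in>K. invertible (jacobian u_NN (at x))) \<and>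
           square_integrable_on
             (\<lambda>x. transformed_field u S H x - transformed_field u_NN S H_NN x) K \<and>
           L2_norm K (\<lambda>x. transformed_field u S H x - transformed_field u_NN S H_NN x) < \<epsilon>"
proof -
  define J where "J x = jacobian u (at x)" for x
  have J: "continuous_on K J" "invertible (J x)" "(u has_derivative (\<lambda>h. J x *v h)) (at x)" for x
    unfolding J_def using C1_diffeomorphism_jacobian[OF assms(2)] continuous_on_subset by blast+
  have gH: "continuous_on K (gradient H)"
    using continuous_on_gradient[OF assms(2)] assms(4) lipschitz_on_continuous_on by blast
  define field where "field p = (matrix_inv (fst p) ** S ** transpose (matrix_inv (fst p))) *v snd p"
    for p :: "(real^'n^'n) \<times> (real^'n)"
  define U :: "((real^'n^'n) \<times> (real^'n)) set" where "U = {p. det (fst p) \<noteq> 0}"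
  have U: "open U" unfolding U_def by (intro open_Collect_neq continuous_intros)
  have field: "continuous_on U field"
    unfolding field_def by (intro continuous_on_transformed continuous_intros) (simp add: U_def invertible_det_nz)
  define Z where "Z = (\<lambda>x. (J x, gradient H x)) ` K"
  have Z: "compact Z"
    unfolding Z_def by (intro compact_continuous_image continuous_intros J gH assms(3))
  have ZU: "Z \<subseteq> U" using J(2) by (auto simp: Z_def U_def invertible_det_nz)
  \<comment> \<open>The summand \<open>1\<close> covers null sets \<open>K\<close>.\<close>
  define e where "e = \<epsilon> / (sqrt (measure lborel K) + 1)"
  have "sqrt (measure lborel K) + 1 > 0" by (intro add_nonneg_pos) auto
  then have "e > 0" using assms(9) by (simp add: e_def)
  from continuous_on_uniform_near_compact[OF Z U ZU field this]
  obtain \<eta> where \<eta>: "\<eta> > 0"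
    "\<And>z w. \<lbrakk>z \<in> Z; dist w z < \<eta>\<rbrakk> \<Longrightarrow> w \<in> U \<and> dist (field w) (field z) < e" by blast
  \<comment> \<open>The error \<open>\<eta>\<close> of the pair is shared by the rows of the Jacobian and the gradient of \<open>H\<close>.\<close>
  define \<zeta> where "\<zeta> = \<eta> / (real CARD('n) + 1)"
  have n1: "real CARD('n) + 1 > 0" by simp
  have "CARD('n) * \<zeta> + \<zeta> = (real CARD('n) + 1) * \<zeta>" by (simp add: distrib_right)
  also have "\<dots> = \<eta>" unfolding \<zeta>_def using n1 by simp
  finally have \<zeta>: "\<zeta> > 0" "CARD('n) * \<zeta> + \<zeta> = \<eta>" using \<eta>(1) n1 by (auto simp: \<zeta>_def)
  have "(H has_derivative (\<lambda>v. v \<bullet> gradient H x)) (at x within K)" for x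
    using GDERIV_gradient[OF assms(1), of x] unfolding gderiv_def by (rule has_derivative_at_withinI)
  then obtain N N' where N: "N \<in> neural_networks \<sigma>" "has_C1_gradient N N'"
      "\<And>x. x \<in> K \<Longrightarrow> norm (N' x - gradient H x) < \<zeta>"
    using network_gradient_approximation[OF assms(3) gH _ assms(5,6) \<zeta>(1)] by blast
  have "\<exists>G\<in>neural_networks \<rho>. \<exists>G'. has_C1_gradient G G' \<and> (\<forall>x\<in>K. norm (G' x - J x $ k) < \<zeta>)" for k
  proof (rule network_gradient_approximation[OF assms(3) _ _ assms(7,8) \<zeta>(1)])
    show "continuous_on K (\<lambda>x. J x $ k)" by (intro continuous_intros J)
    fix x
    have "((\<lambda>x. u x $ k) has_derivative (\<lambda>h. (J x *v h) $ k)) (at x within K)"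
      by (rule has_derivative_at_withinI[OF bounded_linear.has_derivative[OF bounded_linear_vec_nth J(3)]])
    then show "((\<lambda>x. u x $ k) has_derivative (\<lambda>v. v \<bullet> J x $ k)) (at x within K)"
      by (simp add: matrix_vector_mul_component inner_commute)
  qed
  then obtain G G' where G: "\<And>k. G k \<in> neural_networks \<rho>" "\<And>k. has_C1_gradient (G k) (G' k)"
    "\<And>k x. x \<in> K \<Longrightarrow> norm (G' k x - J x $ k) < \<zeta>" by metis
  define v where "v x = (\<Sum>k\<in>UNIV. G k x *\<^sub>R axis k (1::real))" for x
  have v: "v \<in> neural_networks \<rho>"
    unfolding v_def[abs_def]
    by (intro neural_networks_sum neural_networks_linear[OF G(1)]) (auto intro: linear_scaleR_left)
  define J' where "J' x = (\<chi> k. G' k x)" for x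
  have jac: "jacobian v (at x) = J' x" for x
  proof (rule jacobian_eqI)
    have "((\<lambda>x. \<Sum>k\<in>UNIV. G k x *\<^sub>R axis k (1::real)) has_derivative (\<lambda>h. \<Sum>k\<in>UNIV. (h \<bullet> G' k x) *\<^sub>R axis k 1)) (at x)"
      using G(2) by (intro has_derivative_sum has_derivative_scaleR_left) (simp add: has_C1_gradient_def gderiv_def)
    moreover have "(\<Sum>k\<in>UNIV. (h \<bullet> G' k x) *\<^sub>R axis k 1) = J' x *v h" for h
      by (simp add: vec_eq_iff J'_def matrix_vector_mul_component axis_def inner_commute if_distrib cong: if_cong)
    ultimately show "(v has_derivative (\<lambda>h. J' x *v h)) (at x)" by (simp only: v_def[abs_def])
  qed
  have grad: "gradient N x = N' x" for x
    using N(2) by (intro gradient_eqI) (simp add: has_C1_gradient_def)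
  have near: "(J' x, N' x) \<in> U \<and> dist (field (J' x, N' x)) (field (J x, gradient H x)) < e" if x: "x \<in> K" for x
  proof (rule \<eta>(2))
    show "(J x, gradient H x) \<in> Z" using x by (simp add: Z_def)
    have "norm (J' x - J x) < CARD('n) * \<zeta>"
      by (rule norm_vec_less_of_rows) (use G(3)[OF x] in \<open>simp add: J'_def\<close>)
    then show "dist (J' x, N' x) (J x, gradient H x) < \<eta>"
      using norm_Pair_le[of "J' x - J x" "N' x - gradient H x"] N(3)[OF x] \<zeta>(2) by (simp add: dist_norm)
  qed
  have inv': "invertible (J' x)" if "x \<in> K" for x
    using near[OF that] by (simp add: U_def invertible_det_nz)
  define D where "D x = transformed_field u S H x - transformed_field v S N x" for x
  have D_eq: "D = (\<lambda>x. field (J x, gradient H x) - field (J' x, N' x))"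
    by (simp add: D_def transformed_field_def field_def J_def jac grad fun_eq_iff)
  have "continuous_on K J'" "continuous_on K N'"
    using G(2) N(2) unfolding J'_def
    by (auto intro!: continuous_on_vec_lambda intro: continuous_on_subset simp: has_C1_gradient_def)
  then have D: "continuous_on K D"
    unfolding D_eq field_def fst_conv snd_conv
    by (intro continuous_on_diff continuous_on_transformed J gH inv')
  have "norm (D x) \<le> \<epsilon> / (sqrt (measure lborel K) + 1)" if "x \<in> K" for x
    using near[OF that] unfolding e_def[symmetric] by (simp add: D_eq dist_norm norm_minus_commute)
  note L2_norm_less[OF assms(3) D assms(9) this]
  then show ?thesis
    using N(1) v inv' by (intro bexI[of _ N] bexI[of _ v]) (auto simp: jac D_def[abs_def])
qed

end
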